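(* There is an absolute constant $c>0$ such that the following holds. For an arrangement $\mathcal A$ of $n$ pseudolines, color each pseudoline red or blue independently and uniformly at random. Then, with probability tending to $1$ as $n\to\infty$ (uniformly over all such arrangements), the resulting bicolored arrangement contains an alternating dual path of length at least $c\,n^2/\log n$.
   Context: A (Euclidean) pseudoline arrangement is a finite set of $x$-monotone curves in the plane such that each pair crosses exactly once. The pseudolines partition the plane into vertices, edges (maximal pieces of pseudolines containing no vertex) and faces. Each edge receives the color of the pseudoline containing it. A dual path is a sequence of faces such that consecutive faces share an edge and no face appears more than once; its length is the number of faces. A dual path $f_1,\dots,f_m$ is alternating if, with $e_j$ the edge shared by $f_j$ and $f_{j+1}$, no two consecutive edges $e_j,e_{j+1}$ have the same color.
   Formalization: The arrangement is additionally assumed simple (no three pseudolines through a common point); without this the claim fails, since n concurrent lines have only 2n faces. *)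

theory Defs
  imports "HOL-Probability.Probability"
begin

text \<open>
  A pseudoline is an \<open>x\<close>-monotone curve that is unbounded in both directions, that is, the graph
  of a continuous function on the whole real line. It is represented by that function.
\<close>

definition curve :: "(real \<Rightarrow> real) \<Rightarrow> (real \<times> real) set" where
  "curve f = range (\<lambda>x. (x, f x))"

text \<open>
  Two pseudolines cross exactly once: they have a single common point, and they change sides there.
\<close>

definition cross_once :: "(real \<Rightarrow> real) \<Rightarrow> (real \<Rightarrow> real) \<Rightarrow> bool" where
  "cross_once f g \<longleftrightarrow> (\<exists>a. f a = g a \<and>
     ((\<forall>x<a. f x < g x) \<and> (\<forall>x>a. g x < f x) \<or>
      (\<forall>x<a. g x < f x) \<and> (\<forall>x>a. f x < g x)))"

definition pseudoline_arrangement :: "(real \<Rightarrow> real) set \<Rightarrow> bool" where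
  "pseudoline_arrangement A \<longleftrightarrow> finite A \<and> (\<forall>f\<in>A. continuous_on UNIV f) \<and>
     (\<forall>f\<in>A. \<forall>g\<in>A. f \<noteq> g \<longrightarrow> cross_once f g)"

text \<open>
  Simplicity (no three pseudolines through a point) has to be required separately: \<open>n\<close> lines
  through one point have only \<open>2 * n\<close> faces, so no dual path in them has quadratic length, not even
  up to a logarithmic factor.
\<close>

definition simple_arrangement :: "(real \<Rightarrow> real) set \<Rightarrow> bool" where
  "simple_arrangement A \<longleftrightarrow> (\<forall>p. card {f \<in> A. p \<in> curve f} \<le> 2)"

definition vertices :: "(real \<Rightarrow> real) set \<Rightarrow> (real \<times> real) set" where
  "vertices A = {p. \<exists>f\<in>A. \<exists>g\<in>A. f \<noteq> g \<and> p \<in> curve f \<and> p \<in> curve g}"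

definition edges :: "(real \<Rightarrow> real) set \<Rightarrow> (real \<times> real) set set" where
  "edges A = (\<Union>f\<in>A. components (curve f - vertices A))"

definition faces :: "(real \<Rightarrow> real) set \<Rightarrow> (real \<times> real) set set" where
  "faces A = components (- (\<Union>f\<in>A. curve f))"

definition shared_edge ::
  "(real \<Rightarrow> real) set \<Rightarrow> (real \<times> real) set \<Rightarrow> (real \<times> real) set \<Rightarrow> (real \<times> real) set \<Rightarrow> bool" where
  "shared_edge A F G e \<longleftrightarrow> e \<in> edges A \<and> e \<subseteq> frontier F \<and> e \<subseteq> frontier G"

definition dual_path :: "(real \<Rightarrow> real) set \<Rightarrow> (real \<times> real) set list \<Rightarrow> bool" where
  "dual_path A fs \<longleftrightarrow> fs \<noteq> [] \<and> set fs \<subseteq> faces A \<and> distinct fs \<and>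
     (\<forall>j. Suc j < length fs \<longrightarrow> (\<exists>e. shared_edge A (fs ! j) (fs ! Suc j) e))"

datatype colour = Red | Blue

definition edge_colour ::
  "(real \<Rightarrow> real) set \<Rightarrow> ((real \<Rightarrow> real) \<Rightarrow> colour) \<Rightarrow> (real \<times> real) set \<Rightarrow> colour" where
  "edge_colour A col e = col (THE f. f \<in> A \<and> e \<subseteq> curve f)"

text \<open>The definite description above is well defined on edges.\<close>

lemma edge_in_unique_curve:
  assumes "e \<in> edges A"
  shows "\<exists>!f. f \<in> A \<and> e \<subseteq> curve f"
proof -
  obtain f where f: "f \<in> A" "e \<in> components (curve f - vertices A)"
    using assms by (auto simp: edges_def)
  then have sub: "e \<subseteq> curve f - vertices A" and "e \<noteq> {}"
    by (auto dest: in_components_subset in_components_nonempty)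
  then obtain p where p: "p \<in> e" "p \<in> curve f" "p \<notin> vertices A"
    by blast
  have "g = f" if "g \<in> A" "e \<subseteq> curve g" for g
    using that p f(1) by (auto simp: vertices_def)
  with f(1) sub show ?thesis
    by blast
qed

text \<open>
  Two consecutive faces of a dual path share exactly one edge, so the quantification over \<open>e\<close> and
  \<open>e'\<close> below only names the edges crossed between the three faces.
\<close>

definition alternating_dual_path ::
  "(real \<Rightarrow> real) set \<Rightarrow> ((real \<Rightarrow> real) \<Rightarrow> colour) \<Rightarrow> (real \<times> real) set list \<Rightarrow> bool" where
  "alternating_dual_path A col fs \<longleftrightarrow> dual_path A fs \<and>
     (\<forall>j e e'. Suc (Suc j) < length fs \<longrightarrow>
        shared_edge A (fs ! j) (fs ! Suc j) e \<longrightarrow>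
        shared_edge A (fs ! Suc j) (fs ! Suc (Suc j)) e' \<longrightarrow>
        edge_colour A col e \<noteq> edge_colour A col e')"

text \<open>
  The colours of the members of \<open>A\<close> are independent and uniform; outside of \<open>A\<close> the colouring takes
  the irrelevant default value \<open>Red\<close>.
\<close>

definition random_colouring :: "(real \<Rightarrow> real) set \<Rightarrow> ((real \<Rightarrow> real) \<Rightarrow> colour) pmf" where
  "random_colouring A = Pi_pmf A Red (\<lambda>_. pmf_of_set {Red, Blue})"

end

theory Submission
  imports Defs
begin

text \<open>
  Encode a face by the set of pseudolines below it. Direct the dual graph: from a face with \<open>k\<close>
  pseudolines below it one may cross only red edges if \<open>k\<close> is even and only blue edges if \<open>k\<close> is odd.
  Every crossing changes \<open>k\<close> by one, so directed paths alternate. The four faces around a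
  bichromatic vertex form a directed cycle. Hence the boundary of a set of faces that is closed under
  outgoing arcs passes through monochromatic vertices only, and each of its connected pieces runs along
  pseudolines of one colour that no pseudoline of the other colour crosses. With probability tending
  to \<open>1\<close>, any two faces separated by at least \<open>h = O(log n)\<close> pseudolines are separated by
  pseudolines of both colours, so such pieces are short.

  Forbid two families of faces, one attached to the left end of the arrangement and one to the right
  end, so that no member of one is close to a member of the other. A short boundary piece cannot join them, so a directed path leads
  from the bottom to the top avoiding both: otherwise count, modulo \<open>2\<close>, the boundary edges of the
  reachable set on a vertical line that belong to pieces near the left family; this parity does not
  change during a sweep, but it is odd at the far left and even at the far right. Choosing the
  families as interleaved combs, with teeth in rows \<open>O(log n)\<close> apart, forces the path to traverse
  the arrangement \<open>\<Omega>(n / log n)\<close> times, and each traversal has linear length.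
\<close>

section \<open>Columns and sweeping\<close>

text \<open>The number of pseudolines that separate two faces. It bounds from below the number of
  steps between them (\<open>sdist_arc_path\<close>).\<close>

definition sdist :: "'a set \<Rightarrow> 'a set \<Rightarrow> nat" where
  "sdist F G = card (sym_diff F G)"

lemma sdist_commute: "sdist F G = sdist G F"
  by (simp add: sdist_def Un_commute)

lemma sdist_triangle:
  assumes "finite F" "finite G" "finite H"
  shows "sdist F H \<le> sdist F G + sdist G H"
proof -
  have "sym_diff F H \<subseteq> sym_diff F G \<union> sym_diff G H" by blast
  then have "card (sym_diff F H) \<le> card (sym_diff F G \<union> sym_diff G H)"
    using assms by (intro card_mono) auto
  also have "\<dots> \<le> card (sym_diff F G) + card (sym_diff G H)" by (rule card_Un_le)
  finally show ?thesis by (simp add: sdist_def)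
qed

lemma card_le_card_plus_sdist:
  assumes "finite F" "finite G"
  shows "card F \<le> card G + sdist F G"
proof -
  have "card F \<le> card (G \<union> sym_diff F G)"
    using assms by (intro card_mono) auto
  also have "\<dots> \<le> card G + sdist F G" unfolding sdist_def by (rule card_Un_le)
  finally show ?thesis .
qed

lemma sdist_insert: "f \<notin> F \<Longrightarrow> sdist F (insert f F) = 1"
proof -
  assume "f \<notin> F"
  then have "sym_diff F (insert f F) = {f}" by blast
  then show ?thesis by (simp add: sdist_def)
qed

section \<open>Order of two pseudolines that cross once\<close>

lemma cross_once_between:
  assumes "cross_once f g" "f x < g x" "\<not> f x' < g x'" "x < x'"
  shows "\<exists>a. x < a \<and> a \<le> x' \<and> f a = g a"
proof -
  obtain a where a: "f a = g a" "(\<forall>x<a. f x < g x) \<and> (\<forall>x>a. g x < f x) \<or>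
      (\<forall>x<a. g x < f x) \<and> (\<forall>x>a. f x < g x)"
    using assms(1) by (auto simp: cross_once_def)
  have "x < a"
  proof (rule ccontr)
    assume "\<not> x < a"
    then have "a < x \<or> x = a" by auto
    then show False
    proof
      assume "a < x"
      then have "f x' < g x'" using a(2) assms(2,4) by (metis order_less_trans order_less_asym)
      then show False using assms(3) by simp
    qed (use a(1) assms(2) in simp)
  qed
  moreover have "a \<le> x'" using a assms(2-4) \<open>x < a\<close> by (metis leI order_less_asym)
  ultimately show ?thesis using a by blast
qed

lemma cross_once_reverse:
  assumes "cross_once f g" and "\<And>a. f a = g a \<Longrightarrow> x < a \<and> a < x'"
  shows "f x < g x \<longleftrightarrow> g x' < f x'"
proof -
  obtain a where a: "f a = g a" "(\<forall>x<a. f x < g x) \<and> (\<forall>x>a. g x < f x) \<or>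
      (\<forall>x<a. g x < f x) \<and> (\<forall>x>a. f x < g x)"
    using assms(1) by (auto simp: cross_once_def)
  then have "x < a" "a < x'" using assms(2) by auto
  then show ?thesis using a(2) by (metis order_less_asym)
qed

lemma cross_once_unique:
  assumes "cross_once f g" "f x = g x" "f y = g y"
  shows "x = y"
proof -
  obtain a where a: "(\<forall>x<a. f x < g x) \<and> (\<forall>x>a. g x < f x) \<or>
      (\<forall>x<a. g x < f x) \<and> (\<forall>x>a. f x < g x)"
    using assms(1) by (auto simp: cross_once_def)
  have "z = a" if "f z = g z" for z
    using a that by (cases z a rule: linorder_cases) fastforce+
  then show ?thesis using assms by blast
qed

section \<open>Columns of faces over generic abscissae\<close>

locale arrangement =
  fixes A :: "(real \<Rightarrow> real) set"
  assumes pseudoline: "pseudoline_arrangement A"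
    and simple: "simple_arrangement A"
begin

lemma finite_A: "finite A"
  using pseudoline by (simp add: pseudoline_arrangement_def)

lemma cross: "f \<in> A \<Longrightarrow> g \<in> A \<Longrightarrow> f \<noteq> g \<Longrightarrow> cross_once f g"
  using pseudoline by (simp add: pseudoline_arrangement_def)

lemma no_three:
  assumes "f \<in> A" "g \<in> A" "h \<in> A" "f w = g w" "g w = h w" "f \<noteq> g" "g \<noteq> h"
  shows "f = h"
proof (rule ccontr)
  assume "f \<noteq> h"
  have "{f, g, h} \<subseteq> {k \<in> A. (w, g w) \<in> curve k}"
    using assms by (auto simp: curve_def)
  then have "card {f, g, h} \<le> card {k \<in> A. (w, g w) \<in> curve k}"
    using finite_A by (intro card_mono) auto
  also have "\<dots> \<le> 2" using simple by (simp add: simple_arrangement_def)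
  finally show False using assms \<open>f \<noteq> h\<close> by simp
qed

text \<open>Abscissae instead of vertices: several vertices may lie on one vertical line, and
  passing their abscissa then performs several swaps at once.\<close>

definition crossings :: "real set" where
  "crossings = {x. \<exists>f\<in>A. \<exists>g\<in>A. f \<noteq> g \<and> f x = g x}"

abbreviation generic :: "real \<Rightarrow> bool" where
  "generic x \<equiv> x \<notin> crossings"

lemma generic_less: "generic x \<Longrightarrow> f \<in> A \<Longrightarrow> g \<in> A \<Longrightarrow> f \<noteq> g \<Longrightarrow> f x < g x \<or> g x < f x"
  unfolding crossings_def by (auto simp: neq_iff)

lemma crossingsI: "f \<in> A \<Longrightarrow> g \<in> A \<Longrightarrow> f \<noteq> g \<Longrightarrow> f x = g x \<Longrightarrow> x \<in> crossings"
  unfolding crossings_def by blast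

lemma crossings_bound: "finite crossings" "card crossings \<le> (card A)\<^sup>2"
proof -
  let ?w = "\<lambda>(f, g). THE x. f x = (g x :: real)"
  have "crossings \<subseteq> ?w ` (A \<times> A)"
  proof
    fix x assume "x \<in> crossings"
    then obtain f g where fg: "f \<in> A" "g \<in> A" "f \<noteq> g" "f x = g x"
      by (auto simp: crossings_def)
    have "(THE x. f x = g x) = x"
      using cross_once_unique[OF cross[OF fg(1-3)]] fg(4) by (intro the_equality) auto
    then show "x \<in> ?w ` (A \<times> A)" using fg by force
  qed
  moreover have "finite (?w ` (A \<times> A))" using finite_A by simp
  moreover have "card (?w ` (A \<times> A)) \<le> (card A)\<^sup>2"
    using card_image_le[of "A \<times> A" ?w] finite_A by (simp add: card_cartesian_product power2_eq_square)
  ultimately show "finite crossings" "card crossings \<le> (card A)\<^sup>2"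
    by (auto intro: finite_subset dest: card_mono)
qed

definition rank :: "real \<Rightarrow> (real \<Rightarrow> real) \<Rightarrow> nat" where
  "rank x f = card {g \<in> A. g x < f x}"

text \<open>For generic \<open>x\<close> this is the face on the vertical line at \<open>x\<close>
  that has exactly \<open>i\<close> pseudolines below it. Letting \<open>i\<close> run from 0 to
  \<open>card A\<close> gives the whole column of faces.\<close>

definition low :: "real \<Rightarrow> nat \<Rightarrow> (real \<Rightarrow> real) set" where
  "low x i = {f \<in> A. rank x f < i}"

lemma low_subset: "low x i \<subseteq> A"
  by (auto simp: low_def)

lemma finite_low: "finite (low x i)"
  using low_subset finite_A by (rule finite_subset)

lemma low_0 [simp]: "low x 0 = {}"
  by (simp add: low_def)

lemma rank_mono:
  assumes "f \<in> A" "f x < g x"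
  shows "rank x f < rank x g"
  unfolding rank_def using assms finite_A by (intro psubset_card_mono) (auto simp: psubset_eq)

lemma rank_less_iff:
  assumes "generic x" "f \<in> A" "g \<in> A"
  shows "rank x f < rank x g \<longleftrightarrow> f x < g x"
  using rank_mono[of f x g] rank_mono[of g x f] generic_less[OF assms] assms by fastforce

lemma bij_rank:
  assumes "generic x"
  shows "bij_betw (rank x) A {..<card A}"
proof -
  have inj: "inj_on (rank x) A"
    by (intro inj_onI) (metis generic_less assms rank_mono less_irrefl)
  have "rank x f < card A" if "f \<in> A" for f
    unfolding rank_def using that finite_A by (intro psubset_card_mono) auto
  then have "rank x ` A = {..<card A}"
    using inj by (intro card_subset_eq) (auto simp: card_image)
  with inj show ?thesis by (simp add: bij_betw_def)
qed

lemma card_low: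
  assumes "generic x" "i \<le> card A"
  shows "card (low x i) = i"
proof -
  have "rank x ` low x i = {..<i}"
  proof -
    have "rank x ` low x i = rank x ` A \<inter> {..<i}" by (auto simp: low_def)
    then show ?thesis using bij_betw_imp_surj_on[OF bij_rank[OF assms(1)]] assms(2) by auto
  qed
  moreover have "inj_on (rank x) (low x i)"
    using bij_rank[OF assms(1)] low_subset by (auto simp: bij_betw_def intro: inj_on_subset)
  ultimately show ?thesis by (metis card_image card_lessThan)
qed

lemma low_top: "generic x \<Longrightarrow> low x (card A) = A"
  using bij_rank[of x] by (auto simp: low_def bij_betw_def)

lemma low_Suc:
  assumes "generic x" "i < card A"
  obtains f where "f \<in> A" "rank x f = i" "f \<notin> low x i" "low x (Suc i) = insert f (low x i)"
proof -
  have "i \<in> rank x ` A" using bij_rank[OF assms(1)] assms(2) by (auto simp: bij_betw_def)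
  then obtain f where f: "f \<in> A" "rank x f = i" by auto
  have "{g \<in> A. rank x g = i} = {f}"
    using bij_rank[OF assms(1)] f by (auto simp: bij_betw_def inj_on_def)
  moreover have "low x (Suc i) = {g \<in> A. rank x g = i} \<union> low x i"
    by (auto simp: low_def less_Suc_eq)
  ultimately have "low x (Suc i) = insert f (low x i)" by simp
  moreover have "f \<notin> low x i" using f by (simp add: low_def)
  ultimately show ?thesis using f that by blast
qed

lemma low_cut:
  assumes "generic x" "f \<in> low x i" "g \<in> A" "g \<notin> low x i"
  shows "f x < g x"
proof -
  have "f \<in> A" using assms(2) by (simp add: low_def)
  moreover have "rank x f < rank x g" using assms by (auto simp: low_def)
  ultimately show ?thesis using rank_less_iff assms by blast
qed

text \<open>Initial segments of a linear order are nested, so one is determined by its size. This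
  identifies faces of a column without computing any rank.\<close>

lemma cut_eq_low:
  assumes "generic x" "B \<subseteq> A" and cut: "\<And>f g. f \<in> B \<Longrightarrow> g \<in> A \<Longrightarrow> g \<notin> B \<Longrightarrow> f x < g x"
  shows "B = low x (card B)"
proof -
  have cB: "card B \<le> card A" using assms(2) finite_A by (rule card_mono[rotated])
  have "B \<subseteq> low x (card B) \<or> low x (card B) \<subseteq> B"
  proof (rule ccontr)
    assume "\<not> ?thesis"
    then obtain f g where fg: "f \<in> B" "f \<notin> low x (card B)" "g \<notin> B" "g \<in> low x (card B)" by blast
    then have "f x < g x" "g x < f x"
      using cut low_cut[OF assms(1)] low_subset assms(2) by blast+
    then show False by simp
  qed
  moreover have "card (low x (card B)) = card B" using card_low assms(1) cB by blast
  moreover have "finite B" using assms(2) finite_A by (rule finite_subset)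
  ultimately show ?thesis using finite_low by (metis card_subset_eq)
qed

lemma low_eq_of_no_crossing:
  assumes "generic x" "generic x'" "x < x'" "crossings \<inter> {x<..<x'} = {}" "i \<le> card A"
  shows "low x i = low x' i"
proof -
  have "low x i = low x' (card (low x i))"
  proof (rule cut_eq_low[OF assms(2) low_subset])
    fix f g assume fg: "f \<in> low x i" "g \<in> A" "g \<notin> low x i"
    then have "f \<in> A" "f \<noteq> g" using low_subset by auto
    have "f x < g x" using low_cut[OF assms(1)] fg by blast
    show "f x' < g x'"
    proof (rule ccontr)
      assume "\<not> ?thesis"
      then obtain a where a: "x < a" "a \<le> x'" "f a = g a"
        using cross_once_between[OF cross[OF \<open>f \<in> A\<close> fg(2) \<open>f \<noteq> g\<close>] \<open>f x < g x\<close>] assms(3) by blast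
      then have "a \<in> crossings" using \<open>f \<in> A\<close> fg(2) \<open>f \<noteq> g\<close> crossingsI by blast
      then show False using a assms(2,4) by (cases "a = x'") auto
    qed
  qed
  then show ?thesis using card_low assms by simp
qed

text \<open>Two members of \<open>A\<close> that meet strictly between \<open>x\<close> and
  \<open>x'\<close> do so at \<open>w\<close>. Hence neither of the two outer orders can be strictly
  inverted at \<open>w\<close>, and a pair whose order differs at the two ends meets exactly
  there.\<close>

lemma order_at_crossing:
  assumes "generic x" "generic x'" "x < x'" "crossings \<inter> {x<..<x'} = {w}"
    and "f \<in> A" "g \<in> A"
  shows "f x < g x \<Longrightarrow> f w \<le> g w" and "f x' < g x' \<Longrightarrow> f w \<le> g w"
    and "f x < g x \<Longrightarrow> g x' < f x' \<Longrightarrow> f w = g w"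
proof -
  have w: "x < w" "w < x'" using assms(4) by auto
  have only: "a = w" if "x < a" "a < x'" "f a = g a" "f \<noteq> g" for a
  proof -
    have "a \<in> crossings \<inter> {x<..<x'}" using crossingsI[OF assms(5,6) that(4,3)] that(1,2) by simp
    then show ?thesis using assms(4) by simp
  qed
  show "f w \<le> g w" if lt: "f x < g x"
  proof (rule ccontr)
    assume "\<not> ?thesis"
    moreover have "f \<noteq> g" using that by auto
    ultimately obtain a where "x < a" "a \<le> w" "f a = g a"
      using cross_once_between[OF cross[OF assms(5,6) \<open>f \<noteq> g\<close>] lt, of w] w by auto
    then show False using only[of a] \<open>\<not> f w \<le> g w\<close> \<open>f \<noteq> g\<close> w by auto
  qed
  show "f w \<le> g w" if lt: "f x' < g x'"
  proof (rule ccontr)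
    assume gw: "\<not> ?thesis"
    have "f \<noteq> g" using that by auto
    then obtain a where "w < a" "a \<le> x'" "g a = f a"
      using cross_once_between[OF cross[OF assms(6,5)], of w x'] \<open>f \<noteq> g\<close> w gw lt by auto
    then show False using only[of a] that \<open>f \<noteq> g\<close> w by (cases "a = x'") auto
  qed
  show "f w = g w" if lt: "f x < g x" "g x' < f x'"
  proof -
    have "f \<noteq> g" using that by auto
    then obtain a where "x < a" "a \<le> x'" "f a = g a"
      using cross_once_between[OF cross[OF assms(5,6) \<open>f \<noteq> g\<close>] lt(1), of x'] lt(2) assms(3) by auto
    then show ?thesis using only[of a] that \<open>f \<noteq> g\<close> by (cases "a = x'") auto
  qed
qed

text \<open>By simplicity only two pseudolines pass through a vertex. A face of the column that
  changes is therefore replaced by the opposite face at one vertex, while the faces directly below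
  (\<open>B\<close>) and above (\<open>B\<close> with both \<open>f\<close> and \<open>g\<close>)
  remain.\<close>

lemma low_swap:
  assumes gen: "generic x" "generic x'" "x < x'" and one: "crossings \<inter> {x<..<x'} = {w}"
    and i: "i \<le> card A" and neq: "low x i \<noteq> low x' i"
  obtains j f g B where "i = Suc j" "i < card A" "f \<in> A" "g \<in> A" "f \<noteq> g" "f \<notin> B" "g \<notin> B"
    "low x j = B" "low x' j = B" "low x i = insert f B" "low x' i = insert g B"
    "low x (Suc i) = insert f (insert g B)" "low x' (Suc i) = insert f (insert g B)"
proof -
  note ord = order_at_crossing[OF gen one]
  have cards: "card (low x i) = i" "card (low x' i) = i" using card_low gen i by blast+
  then have nsub: "\<not> low x i \<subseteq> low x' i" "\<not> low x' i \<subseteq> low x i"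
    using neq finite_low by (metis card_subset_eq)+
  then obtain f g where f: "f \<in> low x i" "f \<notin> low x' i" and g: "g \<in> low x' i" "g \<notin> low x i"
    by blast
  have fgA: "f \<in> A" "g \<in> A" using f g low_subset by blast+
  have less: "f x < g x" "g x' < f x'" using low_cut gen f g fgA by blast+
  have fg: "f \<noteq> g" "f w = g w" using f g ord(3)[OF fgA less] by auto
  have f_only: "h = f" if "h \<in> low x i" "h \<notin> low x' i" for h
  proof -
    have "h \<in> A" using that low_subset by blast
    have "h w = g w" by (rule ord(3)[OF \<open>h \<in> A\<close> fgA(2)]) (use low_cut gen that g fgA \<open>h \<in> A\<close> in blast)+
    then show ?thesis using no_three[OF \<open>h \<in> A\<close> fgA(2,1)] fg that g by metis
  qed
  have g_only: "h = g" if "h \<in> low x' i" "h \<notin> low x i" for h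
  proof -
    have "h \<in> A" using that low_subset by blast
    have "f w = h w" by (rule ord(3)[OF fgA(1) \<open>h \<in> A\<close>]) (use low_cut gen that f fgA \<open>h \<in> A\<close> in blast)+
    then show ?thesis using no_three[OF fgA(2,1) \<open>h \<in> A\<close>] fg that f by metis
  qed
  define B where "B = low x i - {f}"
  have Lx: "low x i = insert f B" "f \<notin> B" "g \<notin> B" using f g by (auto simp: B_def)
  have Lx': "low x' i = insert g B"
  proof -
    have "h \<in> low x' i" if "h \<in> B" for h using that f_only[of h] by (auto simp: B_def)
    moreover have "h \<in> insert g B" if "h \<in> low x' i" for h
      using that g_only[of h] f by (cases "h \<in> low x i") (auto simp: B_def)
    ultimately show ?thesis using g by blast
  qed
  have BA: "B \<subseteq> A" and finB: "finite B" using low_subset finite_low by (auto simp: B_def)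
  have cB: "Suc (card B) = i" using cards(1) Lx finB by simp
  \<comment> \<open>A pseudoline between \<open>f\<close> and \<open>g\<close> at \<open>w\<close>
    would be a third one through their common point. So no pseudoline gets in between to spoil
    \<open>B\<close> or \<open>T\<close> as an initial segment in either column.\<close>
  have squeeze: False if "h \<in> A" "h \<noteq> f" "h \<noteq> g" "f w \<le> h w" "h w \<le> g w" for h
  proof -
    have "h w = g w" "g w = f w" using that fg by auto
    then have "h = f" using no_three[OF \<open>h \<in> A\<close> fgA(2,1)] \<open>h \<noteq> g\<close> fg(1) by metis
    then show False using \<open>h \<noteq> f\<close> by simp
  qed
  have l1: "B = low x (card B)"
  proof (rule cut_eq_low[OF gen(1) BA])
    fix p q assume pq: "p \<in> B" "q \<in> A" "q \<notin> B"
    show "p x < q x"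
    proof (cases "q = f")
      case True
      have "p \<noteq> f" "p \<noteq> g" "p \<in> A" using pq Lx BA by auto
      have "p x' < f x'" using low_cut[OF gen(2), of p i f] pq f Lx' fgA by auto
      show ?thesis
      proof (rule ccontr)
        assume "\<not> p x < q x"
        then have "f x < p x" using generic_less[OF gen(1) \<open>p \<in> A\<close> fgA(1) \<open>p \<noteq> f\<close>] True by auto
        moreover have "p x < g x" using low_cut[OF gen(1), of p i g] pq Lx g fgA by auto
        ultimately show False using squeeze[OF \<open>p \<in> A\<close> \<open>p \<noteq> f\<close> \<open>p \<noteq> g\<close>] ord(1) fgA \<open>p \<in> A\<close> by blast
      qed
    next
      case False
      then show ?thesis using low_cut[OF gen(1), of p i q] pq Lx by auto
    qed
  qed
  have l2: "B = low x' (card B)"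
  proof (rule cut_eq_low[OF gen(2) BA])
    fix p q assume pq: "p \<in> B" "q \<in> A" "q \<notin> B"
    show "p x' < q x'"
    proof (cases "q = g")
      case True
      have "p \<noteq> f" "p \<noteq> g" "p \<in> A" using pq Lx BA by auto
      show ?thesis
      proof (rule ccontr)
        assume "\<not> p x' < q x'"
        then have "g x' < p x'" using generic_less[OF gen(2) \<open>p \<in> A\<close> fgA(2) \<open>p \<noteq> g\<close>] True by auto
        moreover have "p x' < f x'" using low_cut[OF gen(2), of p i f] pq Lx' f fgA by auto
        ultimately have "g w \<le> p w" "p w \<le> f w" using ord(2) fgA \<open>p \<in> A\<close> by blast+
        then show False using squeeze[OF \<open>p \<in> A\<close> \<open>p \<noteq> f\<close> \<open>p \<noteq> g\<close>] fg by auto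
      qed
    next
      case False
      then show ?thesis using low_cut[OF gen(2), of p i q] pq Lx' by auto
    qed
  qed
  define T where "T = insert f (insert g B)"
  have TA: "T \<subseteq> A" using fgA BA by (auto simp: T_def)
  have cT: "card T = Suc i" using Lx fg finB cB by (simp add: T_def)
  have l3: "T = low x (card T)"
  proof (rule cut_eq_low[OF gen(1) TA])
    fix p q assume pq: "p \<in> T" "q \<in> A" "q \<notin> T"
    show "p x < q x"
    proof (cases "p = g")
      case True
      have "q \<noteq> f" "q \<noteq> g" using pq by (auto simp: T_def)
      show ?thesis
      proof (rule ccontr)
        assume "\<not> p x < q x"
        then have "q x < g x" using generic_less[OF gen(1) \<open>q \<in> A\<close> fgA(2) \<open>q \<noteq> g\<close>] True by auto
        moreover have "f x < q x" using low_cut[OF gen(1), of f i q] pq Lx f by (auto simp: T_def)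
        ultimately show False using squeeze[OF \<open>q \<in> A\<close> \<open>q \<noteq> f\<close> \<open>q \<noteq> g\<close>] ord(1) fgA \<open>q \<in> A\<close> by blast
      qed
    next
      case False
      then show ?thesis using low_cut[OF gen(1), of p i q] pq Lx by (auto simp: T_def)
    qed
  qed
  have l4: "T = low x' (card T)"
  proof (rule cut_eq_low[OF gen(2) TA])
    fix p q assume pq: "p \<in> T" "q \<in> A" "q \<notin> T"
    show "p x' < q x'"
    proof (cases "p = f")
      case True
      have "q \<noteq> f" "q \<noteq> g" using pq by (auto simp: T_def)
      show ?thesis
      proof (rule ccontr)
        assume "\<not> p x' < q x'"
        then have "q x' < f x'" using generic_less[OF gen(2) \<open>q \<in> A\<close> fgA(1) \<open>q \<noteq> f\<close>] True by auto
        moreover have "g x' < q x'" using low_cut[OF gen(2), of g i q] pq Lx' g by (auto simp: T_def)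
        ultimately have "q w \<le> f w" "g w \<le> q w" using ord(2) fgA \<open>q \<in> A\<close> by blast+
        then show False using squeeze[OF \<open>q \<in> A\<close> \<open>q \<noteq> f\<close> \<open>q \<noteq> g\<close>] fg by auto
      qed
    next
      case False
      then show ?thesis using low_cut[OF gen(2), of p i q] pq Lx' by (auto simp: T_def)
    qed
  qed
  have "i < card A" using card_mono[OF finite_A TA] cT by simp
  then show ?thesis
    using that[of "card B" f g B] cB fgA fg(1) Lx Lx' l1 l2 l3 l4 cT T_def by metis
qed

text \<open>Cutting halfway between the first two crossing abscissae splits off an interval with
  exactly one of them, so a transitive relation needs checking only where at most one crossing
  abscissa lies inside.\<close>

lemma sweep_induct:
  assumes "generic x" "generic x'" "x < x'"
    and refl: "\<And>y y'. generic y \<Longrightarrow> generic y' \<Longrightarrow> y < y' \<Longrightarrow> crossings \<inter> {y<..<y'} = {} \<Longrightarrow> R y y'"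
    and step: "\<And>y y' w. generic y \<Longrightarrow> generic y' \<Longrightarrow> y < y' \<Longrightarrow> crossings \<inter> {y<..<y'} = {w} \<Longrightarrow> R y y'"
    and trans: "\<And>x y z. R x y \<Longrightarrow> R y z \<Longrightarrow> R x z"
  shows "R x x'"
  using assms(1-3)
proof (induction "card (crossings \<inter> {x<..<x'})" arbitrary: x rule: less_induct)
  case less
  let ?C = "crossings \<inter> {x<..<x'}"
  have fin: "finite ?C" using crossings_bound by blast
  show ?case
  proof (cases "?C = {}")
    case True
    then show ?thesis using refl less.prems by blast
  next
    case False
    define w where "w = Min ?C"
    have w: "w \<in> ?C" "\<And>a. a \<in> ?C \<Longrightarrow> w \<le> a"
      unfolding w_def using Min_in[OF fin False] Min_le[OF fin] by blast+
    show ?thesis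
    proof (cases "?C = {w}")
      case True
      then show ?thesis using step less.prems by blast
    next
      case no: False
      define w' where "w' = Min (?C - {w})"
      have ne: "?C - {w} \<noteq> {}" using no w by blast
      have w': "w' \<in> ?C - {w}" "\<And>a. a \<in> ?C - {w} \<Longrightarrow> w' \<le> a"
        unfolding w'_def using Min_in[OF _ ne] Min_le[of "?C - {w}"] fin by blast+
      define y where "y = (w + w') / 2"
      have "w < w'" using w' w(2)[of w'] by auto
      then have y: "w < y" "y < w'" by (auto simp: y_def)
      have gy: "generic y"
      proof
        assume "y \<in> crossings"
        then have "y \<in> ?C - {w}" using y w w' by auto
        then show False using w'(2) y by fastforce
      qed
      have one: "crossings \<inter> {x<..<y} = {w}"
      proof -
        have "w \<in> crossings \<inter> {x<..<y}" using w(1) y(1) by simp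
        moreover have "a = w" if "a \<in> crossings \<inter> {x<..<y}" for a
          using that w'(2)[of a] y w' by fastforce
        ultimately show ?thesis by blast
      qed
      have "x < y" "y < x'" using y w(1) w'(1) by auto
      then have "crossings \<inter> {y<..<x'} \<subseteq> ?C" by auto
      moreover have "w \<notin> crossings \<inter> {y<..<x'}" using y(1) by simp
      ultimately have "crossings \<inter> {y<..<x'} \<subset> ?C" using w(1) by blast
      then have "card (crossings \<inter> {y<..<x'}) < card ?C" using fin psubset_card_mono by blast
      then have "R y x'" using less.hyps gy less.prems(2) \<open>y < x'\<close> by blast
      moreover have "R x y" using step[OF less.prems(1) gy \<open>x < y\<close> one] .
      ultimately show ?thesis using trans by blast
    qed
  qed
qed

end

section \<open>Crossing between two barriers\<close>

definition exit_colour :: "nat \<Rightarrow> colour" where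
  "exit_colour k = (if even k then Red else Blue)"

primrec parity :: "(nat \<Rightarrow> bool) \<Rightarrow> nat \<Rightarrow> bool" where
  "parity m 0 = False"
| "parity m (Suc j) = (parity m j \<noteq> m j)"

text \<open>When the marks record every change of \<open>s\<close>, their exclusive or telescopes to
  the change between the two ends.\<close>

lemma parity_telescope:
  fixes m s :: "nat \<Rightarrow> bool"
  assumes "p \<le> q" "\<And>i. p \<le> i \<Longrightarrow> i < q \<Longrightarrow> m i \<longleftrightarrow> s i \<noteq> s (Suc i)"
  shows "parity m q \<longleftrightarrow> (parity m p \<noteq> (s p \<noteq> s q))"
  using assms
proof (induction q rule: dec_induct)
  case (step q)
  have "m q \<longleftrightarrow> s q \<noteq> s (Suc q)" by (rule step.prems) (use step.hyps in auto)
  moreover have "parity m q \<longleftrightarrow> (parity m p \<noteq> (s p \<noteq> s q))"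
    by (rule step.IH) (rule step.prems, simp_all)
  ultimately show ?case unfolding parity.simps by argo
qed simp

lemma parity_constant:
  assumes "p \<le> q" "\<And>i. p \<le> i \<Longrightarrow> i < q \<Longrightarrow> \<not> m i"
  shows "parity m q \<longleftrightarrow> parity m p"
  using parity_telescope[of p q m "\<lambda>_. True"] assms by simp

section \<open>The directed dual graph and the marked boundary edges\<close>

context arrangement
begin

definition cells :: "(real \<Rightarrow> real) set set" where
  "cells = {low x i |x i. generic x \<and> i \<le> card A}"

text \<open>Oriented upwards: \<open>F\<close> is the face just below the common edge,
  \<open>G\<close> the one just above it.\<close>

definition link :: "(real \<Rightarrow> real) set \<Rightarrow> (real \<Rightarrow> real) set \<Rightarrow> bool" where
  "link F G \<longleftrightarrow> (\<exists>x i. generic x \<and> i < card A \<and> F = low x i \<and> G = low x (Suc i))"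

definition arc :: "((real \<Rightarrow> real) \<Rightarrow> colour) \<Rightarrow> (real \<Rightarrow> real) set \<Rightarrow> (real \<Rightarrow> real) set \<Rightarrow> bool" where
  "arc \<kappa> F G \<longleftrightarrow> (link F G \<or> link G F) \<and> (\<forall>f \<in> sym_diff F G. \<kappa> f = exit_colour (card F))"

text \<open>
  Tolerating distance \<open>2\<close> makes all faces around a vertex near as soon as one of them lies in \<open>\<Lambda>\<close>.
\<close>

definition near :: "((real \<Rightarrow> real) \<Rightarrow> colour) \<Rightarrow> (real \<Rightarrow> real) set set \<Rightarrow> colour \<Rightarrow> (real \<Rightarrow> real) set \<Rightarrow> bool" where
  "near \<kappa> \<Lambda> c F \<longleftrightarrow> (\<exists>Z\<in>cells. (\<exists>Y\<in>\<Lambda>. sdist Z Y \<le> 2) \<and> (\<forall>f \<in> sym_diff F Z. \<kappa> f = c))"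

text \<open>Any two faces around a vertex have distance at most 2. So if one of them lies in
  \<Gamma>, none of the four is near \<Lambda>.\<close>

definition separated where
  "separated \<kappa> \<Lambda> \<Gamma> \<longleftrightarrow> (\<forall>F\<in>cells. \<forall>c. near \<kappa> \<Lambda> c F \<longrightarrow> (\<forall>X\<in>\<Gamma>. 2 < sdist F X))"

text \<open>With \<open>W\<close> the forbidden faces, this is the property of the set of faces
  reachable by directed paths that avoid \<open>W\<close>.\<close>

definition arc_closed where
  "arc_closed \<kappa> W S \<longleftrightarrow> (\<forall>F\<in>S. \<forall>G. arc \<kappa> F G \<longrightarrow> G \<in> S \<union> W)"

text \<open>
  \<open>G - F\<close> is meant to be a single pseudoline, the one carrying the edge between \<open>F\<close> and \<open>G\<close>.
\<close>

definition marked where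
  "marked \<kappa> \<Lambda> S F G \<longleftrightarrow> (F \<in> S) \<noteq> (G \<in> S) \<and> (\<exists>f \<in> G - F. near \<kappa> \<Lambda> (\<kappa> f) F)"

lemma low_in_cells: "generic x \<Longrightarrow> i \<le> card A \<Longrightarrow> low x i \<in> cells"
  by (auto simp: cells_def)

lemma cells_subset: "F \<in> cells \<Longrightarrow> F \<subseteq> A"
  using low_subset by (auto simp: cells_def)

lemma finite_cell: "F \<in> cells \<Longrightarrow> finite F"
  using cells_subset finite_A finite_subset by blast

lemma link_cells: "link F G \<Longrightarrow> F \<in> cells \<and> G \<in> cells"
  by (force simp: link_def cells_def)

lemma link_low: "generic x \<Longrightarrow> i < card A \<Longrightarrow> link (low x i) (low x (Suc i))"
  by (auto simp: link_def)

lemma link_insert: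
  assumes "link F G"
  obtains f where "f \<in> A" "f \<notin> F" "G = insert f F"
  using assms low_Suc unfolding link_def by metis

text \<open>The colour \<open>c\<close> is the one allowed in the symmetric difference, so the
  membership of \<open>f\<close> cannot matter. Hence the face below an edge and the face above it
  give the same nearness, which is also passed on through monochromatic vertices.\<close>

lemma near_insert:
  assumes "f \<notin> F" "\<kappa> f = c"
  shows "near \<kappa> \<Lambda> c (insert f F) \<longleftrightarrow> near \<kappa> \<Lambda> c F"
proof -
  have "(\<forall>h \<in> sym_diff (insert f F) Z. \<kappa> h = c) \<longleftrightarrow> (\<forall>h \<in> sym_diff F Z. \<kappa> h = c)" for Z
    using assms by auto
  then show ?thesis by (simp add: near_def)
qed

lemma near_close: "F \<in> cells \<Longrightarrow> Y \<in> \<Lambda> \<Longrightarrow> sdist F Y \<le> 2 \<Longrightarrow> near \<kappa> \<Lambda> c F"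
  unfolding near_def by (intro bexI[of _ F]) auto

lemma marked_insert:
  "f \<notin> F \<Longrightarrow> marked \<kappa> \<Lambda> S F (insert f F) \<longleftrightarrow> (F \<in> S) \<noteq> (insert f F \<in> S) \<and> near \<kappa> \<Lambda> (\<kappa> f) F"
  by (auto simp: marked_def insert_Diff_if)

lemma sdist_square:
  assumes "f \<noteq> g" "f \<notin> B" "g \<notin> B"
    and "F \<in> {B, insert f B, insert g B, insert f (insert g B)}"
    and "G \<in> {B, insert f B, insert g B, insert f (insert g B)}"
  shows "sdist F G \<le> 2"
proof -
  have "sym_diff F G \<subseteq> {f, g}" using assms by auto
  then have "card (sym_diff F G) \<le> card {f, g}" by (intro card_mono) auto
  then show ?thesis using assms(1) by (simp add: sdist_def)
qed

text \<open>The columns on the two sides of a vertex go from \<open>B\<close> to the top face by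
  different ways around it. At a monochromatic vertex all four edges have the same nearness, and a
  closed walk changes membership in \<open>S\<close> an even number of times. At a bichromatic
  vertex, a face in \<Lambda> makes all four faces near, a face in \<Gamma> makes none near, and
  otherwise the four faces form a directed cycle, which lies inside or outside \<open>S\<close> as a
  whole.\<close>

lemma square_parity:
  assumes fg: "f \<noteq> g" "f \<notin> B" "g \<notin> B"
    and links: "link B (insert f B)" "link B (insert g B)"
      "link (insert f B) (insert f (insert g B))" "link (insert g B) (insert f (insert g B))"
    and sep: "separated \<kappa> \<Lambda> \<Gamma>"
    and closed: "arc_closed \<kappa> (\<Lambda> \<union> \<Gamma>) S"
  shows "(marked \<kappa> \<Lambda> S B (insert f B) \<noteq> marked \<kappa> \<Lambda> S (insert f B) (insert f (insert g B))) =
    (marked \<kappa> \<Lambda> S B (insert g B) \<noteq> marked \<kappa> \<Lambda> S (insert g B) (insert f (insert g B)))"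
proof -
  let ?L = "insert f B" and ?R = "insert g B" and ?T = "insert f (insert g B)"
  let ?N = "near \<kappa> \<Lambda>"
  let ?Q = "{B, ?L, ?R, ?T}"
  have T: "?T = insert g ?L" by blast
  have m: "marked \<kappa> \<Lambda> S B ?L \<longleftrightarrow> (B \<in> S) \<noteq> (?L \<in> S) \<and> ?N (\<kappa> f) B"
    "marked \<kappa> \<Lambda> S B ?R \<longleftrightarrow> (B \<in> S) \<noteq> (?R \<in> S) \<and> ?N (\<kappa> g) B"
    "marked \<kappa> \<Lambda> S ?R ?T \<longleftrightarrow> (?R \<in> S) \<noteq> (?T \<in> S) \<and> ?N (\<kappa> f) ?R"
    "marked \<kappa> \<Lambda> S ?L ?T \<longleftrightarrow> (?L \<in> S) \<noteq> (?T \<in> S) \<and> ?N (\<kappa> g) ?L"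
    using fg marked_insert[of f B] marked_insert[of g B] marked_insert[of f ?R] marked_insert[of g ?L]
    by (simp_all add: insert_commute)
  have cells: "?Q \<subseteq> cells" using links link_cells by blast
  show ?thesis
  proof (cases "\<kappa> f = \<kappa> g")
    case True
    have "?N (\<kappa> f) ?R = ?N (\<kappa> f) B" "?N (\<kappa> g) ?L = ?N (\<kappa> g) B"
      using near_insert fg True by simp_all
    then show ?thesis using m True by auto
  next
    case False
    consider Y where "Y \<in> ?Q" "Y \<in> \<Lambda>" | X where "X \<in> ?Q" "X \<in> \<Gamma>" | "?Q \<inter> (\<Lambda> \<union> \<Gamma>) = {}"
      by blast
    then show ?thesis
    proof cases
      case 1
      have "?N c F" if "F \<in> ?Q" for c F
        using near_close[OF _ 1(2)] sdist_square[OF fg that 1(1)] that cells by blast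
      then show ?thesis unfolding m by simp blast
    next
      case 2
      have "\<not> ?N c F" if "F \<in> ?Q" for c F
        using sep 2(2) sdist_square[OF fg that 2(1)] that cells
        unfolding separated_def by (meson in_mono not_le)
      then show ?thesis unfolding m by simp
    next
      case 3
      have fin: "finite B" using finite_cell cells by blast
      have arc_iff: "arc \<kappa> F G \<longleftrightarrow> \<kappa> h = exit_colour (card F)"
        if "link F G \<or> link G F" "sym_diff F G = {h}" for F G h
        using that by (simp add: arc_def)
      have d: "sym_diff B ?L = {f}" "sym_diff ?L B = {f}" "sym_diff B ?R = {g}" "sym_diff ?R B = {g}"
        "sym_diff ?L ?T = {g}" "sym_diff ?T ?L = {g}" "sym_diff ?R ?T = {f}" "sym_diff ?T ?R = {f}"
        using fg by blast+
      have c: "card ?L = Suc (card B)" "card ?R = Suc (card B)" "card ?T = Suc (Suc (card B))"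
        using fg fin by simp_all
      note arcs = arc_iff[OF disjI1[OF links(1)] d(1)] arc_iff[OF disjI2[OF links(1)] d(2)]
        arc_iff[OF disjI1[OF links(2)] d(3)] arc_iff[OF disjI2[OF links(2)] d(4)]
        arc_iff[OF disjI1[OF links(3)] d(5)] arc_iff[OF disjI2[OF links(3)] d(6)]
        arc_iff[OF disjI1[OF links(4)] d(7)] arc_iff[OF disjI2[OF links(4)] d(8)]
      \<comment> \<open>The colours of \<open>f\<close> and \<open>g\<close> differ, so one of them
        is the exit colour of \<open>B\<close> and the other that of the two middle faces. This
        choice only decides the sense in which the cycle runs.\<close>
      have "\<kappa> f = exit_colour (card B) \<and> \<kappa> g = exit_colour (Suc (card B)) \<or>
        \<kappa> g = exit_colour (card B) \<and> \<kappa> f = exit_colour (Suc (card B))"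
        using False by (cases "\<kappa> f"; cases "\<kappa> g") (simp_all add: exit_colour_def)
      moreover have "exit_colour (Suc (Suc (card B))) = exit_colour (card B)"
        by (simp add: exit_colour_def)
      ultimately have "arc \<kappa> B ?L \<and> arc \<kappa> ?L ?T \<and> arc \<kappa> ?T ?R \<and> arc \<kappa> ?R B \<or>
        arc \<kappa> B ?R \<and> arc \<kappa> ?R ?T \<and> arc \<kappa> ?T ?L \<and> arc \<kappa> ?L B"
        unfolding arcs c by auto
      moreover have "G \<in> S" if "F \<in> S" "arc \<kappa> F G" "G \<in> ?Q" for F G
        using closed that 3 unfolding arc_closed_def by blast
      ultimately have "B \<in> S \<longleftrightarrow> ?L \<in> S" "?L \<in> S \<longleftrightarrow> ?T \<in> S" "?R \<in> S \<longleftrightarrow> ?T \<in> S"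
        by (metis insertCI)+
      then show ?thesis unfolding m by simp
    qed
  qed
qed

text \<open>At row \<open>card A\<close> this counts modulo 2 the marked boundary edges on the
  vertical line at \<open>x\<close>; it is the invariant of the sweep.\<close>

definition column_parity where
  "column_parity \<kappa> \<Lambda> S x = parity (\<lambda>i. marked \<kappa> \<Lambda> S (low x i) (low x (Suc i)))"

text \<open>A row that changes lies between two rows that do not. The induction goes down past it by
  two rows and lets \<open>square_parity\<close> compare the two ways around the vertex.\<close>

lemma column_parity_step:
  assumes gen: "generic x" "generic x'" "x < x'" and one: "crossings \<inter> {x<..<x'} = {w}"
    and sep: "separated \<kappa> \<Lambda> \<Gamma>"
    and closed: "arc_closed \<kappa> (\<Lambda> \<union> \<Gamma>) S"
    and "j \<le> card A" "low x j = low x' j"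
  shows "column_parity \<kappa> \<Lambda> S x j = column_parity \<kappa> \<Lambda> S x' j"
  using assms(7,8)
proof (induction j rule: less_induct)
  case (less j)
  show ?case
  proof (cases j)
    case 0
    then show ?thesis by (simp add: column_parity_def)
  next
    case (Suc i)
    show ?thesis
    proof (cases "low x i = low x' i")
      case True
      then have "column_parity \<kappa> \<Lambda> S x i = column_parity \<kappa> \<Lambda> S x' i"
        using less Suc by simp
      then show ?thesis using True less.prems(2) Suc by (simp add: column_parity_def)
    next
      case False
      have "i \<le> card A" using less.prems Suc by simp
      then obtain k f g B where s: "i = Suc k" "i < card A" "f \<in> A" "g \<in> A" "f \<noteq> g" "f \<notin> B" "g \<notin> B"
        "low x k = B" "low x' k = B" "low x i = insert f B" "low x' i = insert g B"
        "low x (Suc i) = insert f (insert g B)" "low x' (Suc i) = insert f (insert g B)"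
        using low_swap[OF gen one _ False] by metis
      have "link B (insert f B)" "link B (insert g B)"
        "link (insert f B) (insert f (insert g B))" "link (insert g B) (insert f (insert g B))"
        using link_low[of x k] link_low[of x' k] link_low[of x i] link_low[of x' i] gen s by simp_all
      note sq = square_parity[OF s(5-7) this sep closed]
      have "column_parity \<kappa> \<Lambda> S x k = column_parity \<kappa> \<Lambda> S x' k"
        using less s Suc by simp
      then show ?thesis
        using sq s Suc unfolding column_parity_def by (simp add: insert_commute) blast
    qed
  qed
qed

lemma column_parity_eq:
  assumes "generic x" "generic x'" "x < x'"
    and sep: "separated \<kappa> \<Lambda> \<Gamma>"
    and closed: "arc_closed \<kappa> (\<Lambda> \<union> \<Gamma>) S"
  shows "column_parity \<kappa> \<Lambda> S x (card A) = column_parity \<kappa> \<Lambda> S x' (card A)"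
  using assms(1-3)
proof (rule sweep_induct)
  fix y y' :: real
  assume y: "generic y" "generic y'" "y < y'" "crossings \<inter> {y<..<y'} = {}"
  have "parity (\<lambda>i. marked \<kappa> \<Lambda> S (low y i) (low y (Suc i))) j =
    parity (\<lambda>i. marked \<kappa> \<Lambda> S (low y' i) (low y' (Suc i))) j" if "j \<le> card A" for j
    using that low_eq_of_no_crossing[OF y] by (induction j) auto
  then show "column_parity \<kappa> \<Lambda> S y (card A) = column_parity \<kappa> \<Lambda> S y' (card A)"
    by (simp add: column_parity_def)
next
  fix y y' w :: real
  assume y: "generic y" "generic y'" "y < y'" "crossings \<inter> {y<..<y'} = {w}"
  show "column_parity \<kappa> \<Lambda> S y (card A) = column_parity \<kappa> \<Lambda> S y' (card A)"
    by (rule column_parity_step[OF y sep closed]) (use low_top y in auto)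
qed simp

lemma sdist_low_Suc: "generic x \<Longrightarrow> i < card A \<Longrightarrow> sdist (low x i) (low x (Suc i)) = 1"
  using link_insert[OF link_low] sdist_insert by metis

text \<open>If \<open>S\<close> stayed below row \<open>b\<close>, every column would enter it at
  the bottom and leave it between rows \<open>a\<close> and \<open>b\<close>. In the column at
  \<open>x\<close> all these changes are marked, giving an odd count; in the column at
  \<open>x'\<close> none is, giving an even count. This contradicts the invariance under the
  sweep.\<close>

lemma barrier_crossing:
  assumes gen: "generic x" "generic x'" "x < x'"
    and rows: "Suc a < b" "b \<le> card A"
    and left: "\<And>i. a < i \<Longrightarrow> i < b \<Longrightarrow> low x i \<in> \<Lambda>"
    and right: "\<And>i. a < i \<Longrightarrow> i < b \<Longrightarrow> low x' i \<in> \<Gamma>"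
    and sep: "separated \<kappa> \<Lambda> \<Gamma>"
    and closed: "arc_closed \<kappa> (\<Lambda> \<union> \<Gamma>) S"
    and start: "\<And>F. F \<in> cells \<Longrightarrow> card F \<le> a \<Longrightarrow> F \<in> S"
  shows "\<exists>F\<in>S. F \<in> cells \<and> b \<le> card F"
proof (rule ccontr)
  assume no: "\<not> ?thesis"
  let ?m = "\<lambda>x i. marked \<kappa> \<Lambda> S (low x i) (low x (Suc i))"
  have lowS: "low y i \<in> S" if "generic y" "i \<le> a" for y i
    using start[of "low y i"] low_in_cells[of y i] card_low[of y i] that rows by simp
  have lownS: "low y i \<notin> S" if "generic y" "b \<le> i" "i \<le> card A" for y i
    using no low_in_cells[of y i] card_low[of y i] that by auto
  have bottom: "parity (?m y) a = parity (?m y) 0" if "generic y" for y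
    by (rule parity_constant) (use lowS that in \<open>auto simp: marked_def\<close>)
  have top: "parity (?m y) (card A) = parity (?m y) b" if "generic y" for y
    by (rule parity_constant) (use lownS that rows in \<open>auto simp: marked_def\<close>)
  \<comment> \<open>Row \<open>a\<close> is not part of the barrier, but row \<open>a + 1\<close> is
    because \<open>Suc a < b\<close>, and it is within the tolerated distance 2.\<close>
  have close: "\<exists>j. a < j \<and> j < b \<and> sdist (low y i) (low y j) \<le> 2"
    if "generic y" "a \<le> i" "i < b" for y i
  proof (cases "i = a")
    case True
    then show ?thesis using sdist_low_Suc[of y a] that rows by (intro exI[of _ "Suc a"]) auto
  next
    case False
    then show ?thesis using that by (intro exI[of _ i]) (auto simp: sdist_def)
  qed
  have cell: "low y i \<in> cells" if "generic y" "i < b" for y i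
    using low_in_cells that rows by simp
  have "?m x i \<longleftrightarrow> (low x i \<in> S) \<noteq> (low x (Suc i) \<in> S)" if i: "a \<le> i" "i < b" for i
  proof -
    have "near \<kappa> \<Lambda> c (low x i)" for c
      using close[OF gen(1) i] near_close[OF cell[OF gen(1) i(2)]] left by blast
    moreover obtain f where "f \<notin> low x i" "low x (Suc i) = insert f (low x i)"
      using low_Suc[OF gen(1) order_less_le_trans[OF i(2) rows(2)]] by metis
    ultimately show ?thesis by (simp add: marked_insert)
  qed
  then have "parity (?m x) b = (parity (?m x) a \<noteq> ((low x a \<in> S) \<noteq> (low x b \<in> S)))"
    using rows by (intro parity_telescope[of a b _ "\<lambda>i. low x i \<in> S"]) auto
  then have left_parity: "column_parity \<kappa> \<Lambda> S x (card A)"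
    using bottom top lowS lownS gen rows by (simp add: column_parity_def)
  have "\<not> ?m x' i" if i: "a \<le> i" "i < b" for i
  proof -
    have "\<not> near \<kappa> \<Lambda> c (low x' i)" for c
      using close[OF gen(2) i] sep cell[OF gen(2) i(2)] right
      unfolding separated_def by (meson not_le)
    then show ?thesis by (simp add: marked_def)
  qed
  then have "parity (?m x') b = parity (?m x') a"
    using rows by (intro parity_constant) auto
  then have "\<not> column_parity \<kappa> \<Lambda> S x' (card A)"
    using bottom top gen by (simp add: column_parity_def)
  then show False using left_parity column_parity_eq[OF gen sep closed] by blast
qed

end

section \<open>Long directed paths\<close>

definition arc_path :: "('a \<Rightarrow> 'a \<Rightarrow> bool) \<Rightarrow> 'a list \<Rightarrow> bool" where
  "arc_path r fs \<longleftrightarrow> fs \<noteq> [] \<and> distinct fs \<and> (\<forall>j. Suc j < length fs \<longrightarrow> r (fs ! j) (fs ! Suc j))"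

lemma arc_path_snoc:
  assumes "arc_path r fs" "r (last fs) y" "y \<notin> set fs"
  shows "arc_path r (fs @ [y])"
  unfolding arc_path_def
proof (intro conjI allI impI)
  fix j assume "Suc j < length (fs @ [y])"
  then consider "Suc j < length fs" | "Suc j = length fs" by fastforce
  then show "r ((fs @ [y]) ! j) ((fs @ [y]) ! Suc j)"
  proof cases
    case 1
    then show ?thesis using assms(1) by (simp add: arc_path_def nth_append)
  next
    case 2
    then have "last fs = fs ! j" by (metis diff_Suc_1 last_conv_nth length_0_conv nat.distinct(1))
    then show ?thesis using 2 assms(2) by (simp add: nth_append)
  qed
qed (use assms in \<open>auto simp: arc_path_def\<close>)

lemma arc_path_take:
  assumes "arc_path r fs" "i < length fs"
  shows "arc_path r (take (Suc i) fs)"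
  using assms by (auto simp: arc_path_def)

context arrangement
begin

lemma arc_cells: "arc \<kappa> F G \<Longrightarrow> F \<in> cells \<and> G \<in> cells"
  using link_cells by (auto simp: arc_def)

lemma arc_sdist:
  assumes "arc \<kappa> F G"
  shows "sdist F G = 1" and "\<bar>int (card G) - int (card F)\<bar> = 1"
proof -
  have *: "sdist F G = 1 \<and> card G = Suc (card F)" if "link F G" for F G
    using link_insert[OF that] sdist_insert finite_cell link_cells[OF that] by (metis card_insert_disjoint)
  show "sdist F G = 1" using assms *[of F G] *[of G F] sdist_commute[of F G] by (auto simp: arc_def)
  show "\<bar>int (card G) - int (card F)\<bar> = 1" using assms *[of F G] *[of G F] by (auto simp: arc_def)
qed

text \<open>Each step crosses one pseudoline. This turns the distance between two places that a path
  must visit into a lower bound for its length.\<close>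

lemma sdist_arc_path:
  assumes "arc_path (arc \<kappa>) fs" "set fs \<subseteq> cells" "s \<le> t" "t < length fs"
  shows "sdist (fs ! s) (fs ! t) \<le> t - s"
  using assms(3,4)
proof (induction t rule: dec_induct)
  case base
  then show ?case by (simp add: sdist_def)
next
  case (step t)
  have fin: "finite (fs ! k)" if "k < length fs" for k
    using that assms(2) finite_cell nth_mem by blast
  have "arc \<kappa> (fs ! t) (fs ! Suc t)" using assms(1) step by (simp add: arc_path_def)
  then have "sdist (fs ! s) (fs ! Suc t) \<le> sdist (fs ! s) (fs ! t) + 1"
    using sdist_triangle[of "fs ! s" "fs ! t" "fs ! Suc t"] fin step arc_sdist(1) by simp
  also have "\<dots> \<le> (t - s) + 1" using step by simp
  finally show ?case using step by simp
qed

section \<open>Distances within and between columns\<close>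

lemma low_mono: "i \<le> j \<Longrightarrow> low x i \<subseteq> low x j"
  by (auto simp: low_def)

lemma sdist_low:
  assumes "generic x" "i \<le> j" "j \<le> card A"
  shows "sdist (low x i) (low x j) = j - i"
proof -
  have "sym_diff (low x i) (low x j) = low x j - low x i" using low_mono[OF assms(2)] by blast
  then show ?thesis
    using card_Diff_subset[OF finite_low low_mono[OF assms(2)]] card_low assms by (simp add: sdist_def)
qed

text \<open>The distance from \<open>F\<close> to row \<open>j\<close> is at least the difference of
  their heights, which is also the distance from row \<open>j\<close> to row \<open>card F\<close>.
  By the triangle inequality, twice the distance to row \<open>j\<close> is then at least
  \<open>2 * H\<close>.\<close>

lemma far_rows:
  assumes "generic x" "F \<in> cells" "2 * H \<le> sdist F (low x (card F))" "j \<le> card A"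
  shows "H \<le> sdist F (low x j)"
proof -
  have F: "finite F" "card F \<le> card A"
    using finite_cell assms(2) card_mono[OF finite_A cells_subset] by auto
  have "sdist (low x j) (low x (card F)) \<le> (if j \<le> card F then card F - j else j - card F)"
    using sdist_low[OF assms(1), of j "card F"] sdist_low[OF assms(1), of "card F" j]
      sdist_commute[of "low x j" "low x (card F)"] assms(4) F(2) by auto
  moreover have "2 * H \<le> sdist F (low x j) + sdist (low x j) (low x (card F))"
    using assms(3) sdist_triangle[OF F(1) finite_low finite_low] by (rule order_trans)
  moreover have "card F \<le> j + sdist F (low x j)" "j \<le> card F + sdist F (low x j)"
    using card_le_card_plus_sdist[OF F(1) finite_low, of x j] card_low[OF assms(1,4)]
      card_le_card_plus_sdist[OF finite_low F(1), of x j] sdist_commute[of F] by simp_all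
  ultimately show ?thesis by (auto split: if_splits)
qed

lemma low_reverse:
  assumes gen: "generic x" "generic x'" and all: "\<And>a. a \<in> crossings \<Longrightarrow> x < a \<and> a < x'"
    and "j \<le> card A"
  shows "low x' j = A - low x (card A - j)"
proof -
  let ?B = "A - low x (card A - j)"
  have "card ?B = j"
    using card_Diff_subset[OF finite_low low_subset] card_low[OF gen(1), of "card A - j"] assms(4) by simp
  moreover have "?B = low x' (card ?B)"
  proof (rule cut_eq_low[OF gen(2)])
    fix f g assume fg: "f \<in> ?B" "g \<in> A" "g \<notin> ?B"
    then have "g x < f x" using low_cut[OF gen(1), of g "card A - j" f] by blast
    moreover have "f \<noteq> g" "f \<in> A" using fg by auto
    ultimately show "f x' < g x'"
      using cross_once_reverse[OF cross, of g f x x'] fg(2) all crossingsI by metis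
  qed simp
  ultimately show ?thesis by simp
qed

text \<open>\<open>low x' j\<close> consists of the topmost \<open>j\<close> pseudolines at
  \<open>x\<close>. Either it is disjoint from the lowest \<open>i\<close>, and the distance is
  \<open>i + j\<close>, or the two sets cover \<open>A\<close>, and the distance counts the
  pseudolines missing from either set.\<close>

lemma sdist_low_opposite:
  assumes gen: "generic x" "generic x'" and all: "\<And>a. a \<in> crossings \<Longrightarrow> x < a \<and> a < x'"
    and j: "q \<le> i" "i \<le> card A - q" "q \<le> j" "j \<le> card A - q"
  shows "2 * q \<le> sdist (low x i) (low x' j)"
proof -
  have le: "i \<le> card A" "j \<le> card A" using j by simp_all
  note rev = low_reverse[OF gen all le(2)]
  have cards: "card (low x i) = i" "card (low x' j) = j" using card_low gen le by auto
  have fin: "finite (sym_diff (low x i) (low x' j))" using finite_low by simp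
  show ?thesis
  proof (cases "i \<le> card A - j")
    case True
    then have "low x i \<inter> low x' j = {}" using rev low_mono[OF True, of x] by blast
    then have "sym_diff (low x i) (low x' j) = low x i \<union> low x' j" and
      "card (low x i \<union> low x' j) = i + j"
      using card_Un_disjoint[OF finite_low finite_low] cards by auto
    then show ?thesis using j by (simp add: sdist_def)
  next
    case False
    then have "low x (card A - j) \<subseteq> low x i" by (intro low_mono) simp
    then have un: "low x i \<union> low x' j = A" using rev low_subset by blast
    then have sub: "(A - low x i) \<union> (A - low x' j) \<subseteq> sym_diff (low x i) (low x' j)" by blast
    have "(A - low x i) \<inter> (A - low x' j) = {}" using un by blast
    then have "card (A - low x i) + card (A - low x' j) \<le> sdist (low x i) (low x' j)"
      using card_mono[OF fin sub] card_Un_disjoint[of "A - low x i" "A - low x' j"] finite_A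
      by (simp add: sdist_def)
    moreover have "card (A - low x i) = card A - i" "card (A - low x' j) = card A - j"
      using card_Diff_subset[OF finite_low low_subset] cards by auto
    ultimately show ?thesis using j le by linarith
  qed
qed

lemma outer_abscissae:
  "\<exists>x x'. generic x \<and> generic x' \<and> x < x' \<and> (\<forall>a\<in>crossings. x < a \<and> a < x')"
proof -
  obtain b where b: "\<And>a. a \<in> crossings \<Longrightarrow> \<bar>a\<bar> \<le> b"
    using finite_imp_bounded[OF crossings_bound(1)] by (auto simp: bounded_iff)
  define c where "c = max b 0 + 1"
  have "- c < a \<and> a < c" if "a \<in> crossings" for a using b[OF that] by (auto simp: c_def)
  moreover have "-c < c" by (simp add: c_def)
  moreover have "generic (-c)" "generic c" using calculation(1) less_irrefl by blast+
  ultimately show ?thesis by blast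
qed

text \<open>There are two colours, so the quantification over \<open>c\<close> says that pseudolines
  of both colours separate \<open>F\<close> from \<open>G\<close>.\<close>

definition mixed :: "nat \<Rightarrow> ((real \<Rightarrow> real) \<Rightarrow> colour) \<Rightarrow> bool" where
  "mixed h \<kappa> \<longleftrightarrow> (\<forall>F\<in>cells. \<forall>G\<in>cells. \<forall>c. h \<le> sdist F G \<longrightarrow> (\<exists>f \<in> sym_diff F G. \<kappa> f \<noteq> c))"

text \<open>A face \<open>F\<close> that is near is less than \<open>h\<close> away from some
  \<open>Z\<close>, and \<open>Z\<close> is at most 2 away from \<Lambda>. Distance
  \<open>h + 4\<close> between the families leaves at least 3 from \<open>F\<close> to
  \<Gamma>.\<close>

lemma mixed_separated:
  assumes "mixed h \<kappa>" "\<Lambda> \<subseteq> cells" "\<Gamma> \<subseteq> cells"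
    and far: "\<And>Y X. Y \<in> \<Lambda> \<Longrightarrow> X \<in> \<Gamma> \<Longrightarrow> h + 4 \<le> sdist Y X"
  shows "separated \<kappa> \<Lambda> \<Gamma>"
  unfolding separated_def
proof (intro ballI allI impI)
  fix F c X assume F: "F \<in> cells" "near \<kappa> \<Lambda> c F" and X: "X \<in> \<Gamma>"
  obtain Z Y where Z: "Z \<in> cells" "\<forall>f \<in> sym_diff F Z. \<kappa> f = c" and Y: "Y \<in> \<Lambda>" "sdist Z Y \<le> 2"
    using F(2) by (auto simp: near_def)
  have "sdist F Z < h" using assms(1) F(1) Z unfolding mixed_def by (meson not_le)
  have fin: "finite F" "finite Z" "finite Y" "finite X"
    using finite_cell F(1) Z(1) Y(1) X assms(2,3) by blast+
  have "sdist Y X \<le> sdist Y F + sdist F X" "sdist Y F \<le> sdist Y Z + sdist Z F"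
    using sdist_triangle fin by blast+
  then show "2 < sdist F X"
    using far[OF Y(1) X] Y(2) \<open>sdist F Z < h\<close> sdist_commute[of Y Z] sdist_commute[of Z F] by linarith
qed

text \<open>\<open>H\<close> is the spacing of the teeth and \<open>t\<close> the number of tooth
  rows that are used. The path passes each tooth row only close to the open end of its tooth,
  alternately at the right and at the left. The end columns are at least \<open>2 * q\<close> apart
  and each end costs less than \<open>2 * H\<close>, so each of the \<open>t - 1\<close> passages
  takes at least \<open>2 * q - 4 * H\<close> steps.\<close>

lemma long_arc_path:
  assumes mix: "mixed h \<kappa>" and H: "H = h + 4" "H \<le> 2 * q" and n: "2 * q + 2 \<le> card A"
    and t: "1 \<le> t" "q + t * H < card A - q"
  shows "\<exists>fs. arc_path (arc \<kappa>) fs \<and> set fs \<subseteq> cells \<and> (t - 1) * (2 * q - 4 * H) \<le> length fs"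
proof -
  obtain x x' where gen: "generic x" "generic x'" "x < x'"
    and outer: "\<forall>a\<in>crossings. x < a \<and> a < x'"
    using outer_abscissae by blast
  have all: "x < a \<and> a < x'" if "a \<in> crossings" for a using outer that by blast
  define b where "b = card A - q"
  have b: "Suc q < b" "b \<le> card A" "q + t * H < b" using n t by (auto simp: b_def)
  \<comment> \<open>All of one extreme column between rows \<open>q\<close> and \<open>b\<close>, and teeth in the rows \<open>q + i * H\<close> with \<open>P i\<close>
    that stop at distance \<open>2 * H\<close> from the opposite column.\<close>
  define comb where "comb y y' P = {low y i |i. q < i \<and> i < b} \<union>
    {F \<in> cells. card F < b \<and> (\<exists>i>0. P i \<and> card F = q + i * H) \<and> 2 * H \<le> sdist F (low y' (card F))}"
    for y y' and P :: "nat \<Rightarrow> bool"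
  define \<Lambda> where "\<Lambda> = comb x x' odd"
  define \<Gamma> where "\<Gamma> = comb x' x even"
  have comb_cells: "comb y y' P \<subseteq> cells" if "generic y" for y y' P
    using that low_in_cells b by (auto simp: comb_def)
  have \<Lambda>\<Gamma>: "\<Lambda> \<subseteq> cells" "\<Gamma> \<subseteq> cells" using comb_cells gen by (auto simp: \<Lambda>_def \<Gamma>_def)
  have opp: "2 * q \<le> sdist (low x i) (low x' j)" if "q \<le> i" "i \<le> b" "q \<le> j" "j \<le> b" for i j
    using sdist_low_opposite[OF gen(1,2) all] that by (simp add: b_def)
  have far: "h + 4 \<le> sdist Y X" if Y: "Y \<in> \<Lambda>" and X: "X \<in> \<Gamma>" for Y X
  proof -
    \<comment> \<open>Two columns are far apart by \<open>opp\<close>, a column and the opposite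
      teeth by \<open>far_rows\<close>, and two teeth because their rows have different parity and
      hence heights at least \<open>H\<close> apart.\<close>
    consider (sides) i j where "Y = low x i" "X = low x' j" "q < i" "i < b" "q < j" "j < b"
      | (left) i where "Y = low x i" "i < b" "2 * H \<le> sdist X (low x (card X))"
      | (right) j where "X = low x' j" "j < b" "2 * H \<le> sdist Y (low x' (card Y))"
      | (teeth) i j where "odd i" "even j" "card Y = q + i * H" "card X = q + j * H"
      using X Y unfolding \<Lambda>_def \<Gamma>_def comb_def by auto
    then show ?thesis
    proof cases
      case sides
      then show ?thesis using opp[of i j] H by simp
    next
      case left
      then show ?thesis
        using far_rows[OF gen(1) _ left(3), of i] X \<Lambda>\<Gamma> b H sdist_commute[of X] by auto
    next
      case right
      then show ?thesis
        using far_rows[OF gen(2) _ right(3), of j] Y \<Lambda>\<Gamma> b H by auto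
    next
      case teeth
      have fin: "finite X" "finite Y" using X Y \<Lambda>\<Gamma> finite_cell by blast+
      have "i \<noteq> j" using teeth by blast
      then have "Suc i \<le> j \<or> Suc j \<le> i" by linarith
      then have "Suc i * H \<le> j * H \<or> Suc j * H \<le> i * H" by (meson mult_le_mono1)
      then show ?thesis
        using card_le_card_plus_sdist[OF fin] card_le_card_plus_sdist[OF fin(2,1)]
          sdist_commute[of X Y] teeth H by auto
    qed
  qed
  have sep: "separated \<kappa> \<Lambda> \<Gamma>" by (rule mixed_separated[OF mix \<Lambda>\<Gamma> far])
  have high: "q < card F" if "F \<in> comb y y' P" "generic y" for F y y' P
    using that b H card_low[of y] by (auto simp: comb_def)
  define S where "S = {G. \<exists>fs. arc_path (arc \<kappa>) fs \<and> set fs \<subseteq> cells - (\<Lambda> \<union> \<Gamma>) \<and>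
    card (hd fs) \<le> q \<and> last fs = G}"
  have SI: "last fs \<in> S"
    if "arc_path (arc \<kappa>) fs" "set fs \<subseteq> cells - (\<Lambda> \<union> \<Gamma>)" "card (hd fs) \<le> q" for fs
    using that by (auto simp: S_def)
  have "arc_closed \<kappa> (\<Lambda> \<union> \<Gamma>) S"
    unfolding arc_closed_def
  proof (intro ballI allI impI)
    fix F G assume F: "F \<in> S" and FG: "arc \<kappa> F G"
    obtain fs where fs: "arc_path (arc \<kappa>) fs" "set fs \<subseteq> cells - (\<Lambda> \<union> \<Gamma>)" "card (hd fs) \<le> q" "last fs = F"
      using F by (auto simp: S_def)
    then have ne: "fs \<noteq> []" by (simp add: arc_path_def)
    have "G \<in> S" if G: "G \<notin> \<Lambda> \<union> \<Gamma>"
    \<comment> \<open>Paths have to stay simple: a face visited before is reached by a prefix, a new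
      one by appending it.\<close>
    proof (cases "G \<in> set fs")
      case True
      then obtain i where i: "i < length fs" "fs ! i = G" by (auto simp: in_set_conv_nth)
      have "last (take (Suc i) fs) = G" using i by (simp add: take_Suc_conv_app_nth)
      moreover have "hd (take (Suc i) fs) = hd fs" by simp
      moreover have "set (take (Suc i) fs) \<subseteq> cells - (\<Lambda> \<union> \<Gamma>)"
        using set_take_subset fs(2) by (rule order_trans)
      ultimately show ?thesis
        using SI[OF arc_path_take[OF fs(1) i(1)]] fs(3) by simp
    next
      case False
      have "arc_path (arc \<kappa>) (fs @ [G])" using arc_path_snoc[OF fs(1) _ False] FG fs(4) by simp
      moreover have "set (fs @ [G]) \<subseteq> cells - (\<Lambda> \<union> \<Gamma>)" using fs(2) G arc_cells[OF FG] by auto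
      moreover have "hd (fs @ [G]) = hd fs" "last (fs @ [G]) = G" using ne by simp_all
      ultimately show ?thesis using SI fs(3) by metis
    qed
    then show "G \<in> S \<union> (\<Lambda> \<union> \<Gamma>)" by blast
  qed
  moreover have "F \<in> S" if "F \<in> cells" "card F \<le> q" for F
  proof -
    have "F \<notin> \<Lambda> \<union> \<Gamma>" using high gen that(2) unfolding \<Lambda>_def \<Gamma>_def by (meson UnE not_le)
    then show ?thesis using SI[of "[F]"] that by (simp add: arc_path_def)
  qed
  moreover have "low x i \<in> \<Lambda>" "low x' i \<in> \<Gamma>" if "q < i" "i < b" for i
    using that by (auto simp: \<Lambda>_def \<Gamma>_def comb_def)
  ultimately have "\<exists>F\<in>S. F \<in> cells \<and> b \<le> card F"
    using barrier_crossing[OF gen b(1,2) _ _ sep] by blast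
  then obtain fs where fs: "arc_path (arc \<kappa>) fs" "set fs \<subseteq> cells - (\<Lambda> \<union> \<Gamma>)" "card (hd fs) \<le> q"
    "b \<le> card (last fs)" by (auto simp: S_def)
  then have ne: "fs \<noteq> []" by (simp add: arc_path_def)
  let ?m = "length fs"
  have cell: "fs ! s \<in> cells" "fs ! s \<notin> \<Lambda>" "fs ! s \<notin> \<Gamma>" if "s < ?m" for s
    using fs(2) nth_mem[OF that] by blast+
  \<comment> \<open>The height changes by one in each step and ends at \<open>b\<close> or higher,
    so a discrete intermediate value argument applies.\<close>
  have ivt: "\<exists>s'. s \<le> s' \<and> s' < ?m \<and> card (fs ! s') = k"
    if "s < ?m" "card (fs ! s) \<le> k" "k < b" for s k
  proof -
    have "\<exists>s'\<ge>s. s' \<le> ?m - 1 \<and> int (card (fs ! s')) = int k"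
    proof (rule nat_intermed_int_val)
      show "\<forall>i. s \<le> i \<and> i < ?m - 1 \<longrightarrow> \<bar>int (card (fs ! Suc i)) - int (card (fs ! i))\<bar> \<le> 1"
        using fs(1) arc_sdist(2) unfolding arc_path_def
        by (metis less_diff_conv add.commute plus_1_eq_Suc order_refl)
      show "int k \<le> int (card (fs ! (?m - 1)))" using fs(4) that(3) ne by (simp add: last_conv_nth)
    qed (use that in auto)
    then show ?thesis using that(1) by (metis Suc_pred' length_greater_0_conv less_Suc_eq_le ne of_nat_eq_iff)
  qed
  \<comment> \<open>Farther from the column that its tooth faces, the face would belong to the
    tooth. Odd teeth start at \<open>x\<close> and leave a gap at \<open>x'\<close>, even ones the
    reverse.\<close>
  have tooth: "sdist (fs ! s) (low (if odd i then x' else x) (q + i * H)) < 2 * H"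
    if "s < ?m" "card (fs ! s) = q + i * H" "0 < i" "q + i * H < b" for s i
  proof (rule ccontr)
    let ?F = "fs ! s"
    assume "\<not> ?thesis"
    moreover have "?F \<in> comb y y' P" if "P i" "2 * H \<le> sdist ?F (low y' (card ?F))" for y y' P
      using that \<open>s < ?m\<close> \<open>card ?F = q + i * H\<close> \<open>0 < i\<close> \<open>q + i * H < b\<close> cell(1)
      unfolding comb_def by auto
    ultimately have "?F \<in> \<Lambda> \<or> ?F \<in> \<Gamma>"
      using that(2) unfolding \<Lambda>_def \<Gamma>_def by (cases "odd i") (simp_all add: not_less)
    then show False using cell that(1) by blast
  qed
  have gap: "2 * q - 4 * H \<le> sdist (fs ! s) (fs ! s')"
    if s: "s < ?m" "card (fs ! s) = q + i * H" "s' < ?m" "card (fs ! s') = q + Suc i * H"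
      and i: "0 < i" "q + Suc i * H < b" for s s' i
  proof -
    define y where "y = (if odd i then x' else x)"
    define y' where "y' = (if odd i then x else x')"
    have 1: "sdist (fs ! s) (low y (q + i * H)) < 2 * H"
      using tooth[OF s(1,2) i(1)] i(2) by (simp add: y_def)
    have 2: "sdist (fs ! s') (low y' (q + Suc i * H)) < 2 * H"
      using tooth[OF s(3,4) _ i(2)] by (simp add: y'_def split: if_splits)
    have 3: "2 * q \<le> sdist (low y (q + i * H)) (low y' (q + Suc i * H))"
      using opp[of "q + i * H" "q + Suc i * H"] opp[of "q + Suc i * H" "q + i * H"] i(2)
        sdist_commute[of "low x' (q + i * H)"] by (simp add: y_def y'_def)
    have fin: "finite (fs ! s)" "finite (fs ! s')" using cell s finite_cell by auto
    have "sdist (low y (q + i * H)) (low y' (q + Suc i * H)) \<le>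
        sdist (low y (q + i * H)) (fs ! s) + sdist (fs ! s) (low y' (q + Suc i * H))"
      "sdist (fs ! s) (low y' (q + Suc i * H)) \<le>
        sdist (fs ! s) (fs ! s') + sdist (fs ! s') (low y' (q + Suc i * H))"
      using sdist_triangle finite_low fin by blast+
    then show ?thesis using 1 2 3 sdist_commute[of "low y (q + i * H)" "fs ! s"] by linarith
  qed
  have "\<exists>s<?m. card (fs ! s) = q + i * H \<and> (i - 1) * (2 * q - 4 * H) \<le> s" if "1 \<le> i" "i \<le> t" for i
    using that
  proof (induction i rule: dec_induct)
    case base
    have "0 < ?m" "card (fs ! 0) \<le> q" using ne fs(3) by (simp_all add: hd_conv_nth)
    moreover have "1 * H \<le> t * H" using t by (intro mult_le_mono1)
    then have "q + 1 * H < b" using b(3) by linarith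
    ultimately show ?case using ivt[of 0 "q + 1 * H"] by auto
  next
    case (step i)
    then obtain s where s: "s < ?m" "card (fs ! s) = q + i * H" "(i - 1) * (2 * q - 4 * H) \<le> s" by auto
    have "Suc i * H \<le> t * H" using step by (intro mult_le_mono1)
    then have lt: "q + Suc i * H < b" using b by linarith
    then obtain s' where s': "s \<le> s'" "s' < ?m" "card (fs ! s') = q + Suc i * H"
      using ivt[OF s(1), of "q + Suc i * H"] s(2) by auto
    have "2 * q - 4 * H \<le> s' - s"
      using gap[OF s(1,2) s'(2,3) _ lt] sdist_arc_path[OF fs(1) _ s'(1,2)] fs(2) step by fastforce
    moreover have "(Suc i - 1) * (2 * q - 4 * H) = (i - 1) * (2 * q - 4 * H) + (2 * q - 4 * H)"
      using step by (cases i) simp_all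
    ultimately have "(Suc i - 1) * (2 * q - 4 * H) \<le> s'" using s(3) s'(1) by linarith
    then show ?case using s' by blast
  qed
  then obtain s where "s < ?m" "(t - 1) * (2 * q - 4 * H) \<le> s" using t(1) by blast
  then show ?thesis using fs by (intro exI[of _ fs]) auto
qed

end

section \<open>Faces and edges\<close>

lemma connected_same_sign:
  fixes \<phi> :: "'a::topological_space \<Rightarrow> real"
  assumes "connected C" "continuous_on C \<phi>" "\<And>z. z \<in> C \<Longrightarrow> \<phi> z \<noteq> 0" "p \<in> C" "q \<in> C" "0 < \<phi> p"
  shows "0 < \<phi> q"
proof (rule ccontr)
  assume "\<not> 0 < \<phi> q"
  then have "\<phi> q < 0" using assms(3)[OF assms(5)] by simp
  moreover have "connected (\<phi> ` C)" using assms by (intro connected_continuous_image)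
  ultimately have "0 \<in> \<phi> ` C"
    using connectedD_interval[of "\<phi> ` C" "\<phi> q" "\<phi> p" 0] assms by auto
  then show False using assms(3) by force
qed

lemma continuous_on_Max:
  fixes f :: "'i \<Rightarrow> 'a::topological_space \<Rightarrow> real"
  assumes "finite I" "I \<noteq> {}" "\<And>i. i \<in> I \<Longrightarrow> continuous_on T (f i)"
  shows "continuous_on T (\<lambda>x. Max ((\<lambda>i. f i x) ` I))"
  using assms
proof (induction I rule: finite_ne_induct)
  case (insert i I)
  then have "continuous_on T (\<lambda>x. max (f i x) (Max ((\<lambda>i. f i x) ` I)))"
    by (intro continuous_on_max) auto
  then show ?case using insert by simp
qed simp

lemma continuous_on_Min:
  fixes f :: "'i \<Rightarrow> 'a::topological_space \<Rightarrow> real"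
  assumes "finite I" "I \<noteq> {}" "\<And>i. i \<in> I \<Longrightarrow> continuous_on T (f i)"
  shows "continuous_on T (\<lambda>x. Min ((\<lambda>i. f i x) ` I))"
  using assms
proof (induction I rule: finite_ne_induct)
  case (insert i I)
  then have "continuous_on T (\<lambda>x. min (f i x) (Min ((\<lambda>i. f i x) ` I)))"
    by (intro continuous_on_min) auto
  then show ?case using insert by simp
qed simp

lemma cross_once_convex:
  assumes "cross_once f g" "f x < g x" "f x' < g x'" "x \<le> z" "z \<le> x'"
  shows "f z < g z"
proof -
  obtain a where a: "f a = g a" "(\<forall>x<a. f x < g x) \<and> (\<forall>x>a. g x < f x) \<or>
      (\<forall>x<a. g x < f x) \<and> (\<forall>x>a. f x < g x)"
    using assms(1) by (auto simp: cross_once_def)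
  from a(2) show ?thesis
  proof
    assume *: "(\<forall>x<a. f x < g x) \<and> (\<forall>x>a. g x < f x)"
    have "x' < a"
    proof (rule ccontr)
      assume "\<not> x' < a"
      then have "x' = a \<or> a < x'" by auto
      then show False using * a(1) assms(3) by (metis order_less_asym order_less_irrefl)
    qed
    then show ?thesis using * assms(5) by auto
  next
    assume *: "(\<forall>x<a. g x < f x) \<and> (\<forall>x>a. f x < g x)"
    have "a < x"
    proof (rule ccontr)
      assume "\<not> a < x"
      then have "x = a \<or> x < a" by auto
      then show False using * a(1) assms(2) by (metis order_less_asym order_less_irrefl)
    qed
    then show ?thesis using * assms(4) by auto
  qed
qed

lemma finite_separation:
  fixes S T :: "real set"
  assumes "finite S" "finite T" "\<And>a b. a \<in> S \<Longrightarrow> b \<in> T \<Longrightarrow> a < b"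
  shows "\<exists>y. (\<forall>a\<in>S. a < y) \<and> (\<forall>b\<in>T. y < b)"
proof -
  consider "S = {}" | "T = {}" | "S \<noteq> {}" "T \<noteq> {}" by blast
  then show ?thesis
  proof cases
    case 1
    have "Min (insert 0 T) - 1 < b" if "b \<in> T" for b
    proof -
      have "Min (insert 0 T) \<le> b" using assms(2) that by (intro Min_le) auto
      then show ?thesis by linarith
    qed
    then show ?thesis using 1 by blast
  next
    case 2
    have "a < Max (insert 0 S) + 1" if "a \<in> S" for a
    proof -
      have "a \<le> Max (insert 0 S)" using assms(1) that by (intro Max_ge) auto
      then show ?thesis by linarith
    qed
    then show ?thesis using 2 by blast
  next
    case 3
    then have "Max S < Min T" using assms by simp
    then obtain y where "Max S < y" "y < Min T" using dense by blast
    then show ?thesis using 3 assms(1,2) by (intro exI[of _ y]) auto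
  qed
qed

text \<open>Over each abscissa the strip is the interval between the maximum of \<open>I\<close> and
  the minimum of \<open>J\<close>. The joining curve moves the abscissa linearly and interpolates
  the relative height within this interval, so it stays strictly inside.\<close>

lemma strip_connected:
  fixes I :: "(real \<Rightarrow> real) set"
  assumes fin: "finite I" "finite J" and ne: "I \<noteq> {}" "J \<noteq> {}"
    and cont: "\<And>f. f \<in> I \<union> J \<Longrightarrow> continuous_on UNIV f"
    and less: "\<And>f g z. f \<in> I \<Longrightarrow> g \<in> J \<Longrightarrow> z \<in> {min x x'..max x x'} \<Longrightarrow> f z < g z"
    and p: "\<And>f. f \<in> I \<Longrightarrow> f x < y" "\<And>g. g \<in> J \<Longrightarrow> y < g x"
    and p': "\<And>f. f \<in> I \<Longrightarrow> f x' < y'" "\<And>g. g \<in> J \<Longrightarrow> y' < g x'"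
  shows "\<exists>T. connected T \<and> (x, y) \<in> T \<and> (x', y') \<in> T \<and>
    (\<forall>z\<in>T. (\<forall>f\<in>I. f (fst z) < snd z) \<and> (\<forall>g\<in>J. snd z < g (fst z)))"
proof -
  define lo where "lo z = Max ((\<lambda>f. f z) ` I)" for z
  define hi where "hi z = Min ((\<lambda>f. f z) ` J)" for z
  have lohi: "lo z < hi z" if "z \<in> {min x x'..max x x'}" for z
    using fin ne less[OF _ _ that] unfolding lo_def hi_def by (auto simp: Max_less_iff)
  have lo: "f z \<le> lo z" if "f \<in> I" for f z using that fin(1) by (auto simp: lo_def)
  have hi: "hi z \<le> g z" if "g \<in> J" for g z using that fin(2) by (auto simp: hi_def)
  have y: "lo x < y" "y < hi x" "lo x' < y'" "y' < hi x'"
    using fin ne p p' by (auto simp: lo_def hi_def)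
  have c: "continuous_on UNIV lo" "continuous_on UNIV hi"
    unfolding lo_def hi_def using fin ne cont by (auto intro!: continuous_on_Max continuous_on_Min)
  define X where "X t = x + t * (x' - x)" for t
  define u where "u = (y - lo x) / (hi x - lo x)"
  define u' where "u' = (y' - lo x') / (hi x' - lo x')"
  have u: "0 < u" "u < 1" "0 < u'" "u' < 1" using y by (auto simp: u_def u'_def)
  define \<gamma> where "\<gamma> t = (X t, lo (X t) + ((1 - t) * u + t * u') * (hi (X t) - lo (X t)))" for t
  have "continuous_on {0..1} \<gamma>"
    unfolding \<gamma>_def X_def
    by (intro continuous_intros continuous_on_compose2[OF c(1)] continuous_on_compose2[OF c(2)]) auto
  then have "connected (\<gamma> ` {0..1})" by (rule connected_continuous_image) simp
  moreover have "\<gamma> 0 = (x, y)" "\<gamma> 1 = (x', y')"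
    using y by (simp_all add: \<gamma>_def X_def u_def u'_def)
  then have "(x, y) \<in> \<gamma> ` {0..1}" "(x', y') \<in> \<gamma> ` {0..1}"
    by (metis atLeastAtMost_iff image_eqI order_refl zero_le_one)+
  moreover have "(\<forall>f\<in>I. f (fst (\<gamma> t)) < snd (\<gamma> t)) \<and> (\<forall>g\<in>J. snd (\<gamma> t) < g (fst (\<gamma> t)))"
    if t: "t \<in> {0..1}" for t
  proof -
    have "X t \<in> closed_segment x x'"
      using t by (auto simp: closed_segment_def X_def algebra_simps intro!: exI[of _ t])
    then have X: "X t \<in> {min x x'..max x x'}" by (auto simp: closed_segment_eq_real_ivl split: if_splits)
    define v where "v = (1 - t) * u + t * u'"
    have "v \<in> closed_segment u u'"
      using t by (auto simp: closed_segment_def v_def algebra_simps intro!: exI[of _ t])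
    then have v: "0 < v" "v < 1" using u by (auto simp: closed_segment_eq_real_ivl split: if_splits)
    let ?d = "hi (X t) - lo (X t)"
    have d: "0 < ?d" using lohi[OF X] by simp
    have "0 < v * ?d" "v * ?d < 1 * ?d" using v d by (auto intro: mult_strict_right_mono)
    then have "lo (X t) < snd (\<gamma> t)" "snd (\<gamma> t) < hi (X t)" by (simp_all add: \<gamma>_def v_def)
    then show ?thesis using lo[of _ "X t"] hi[of _ "X t"] by (fastforce simp: \<gamma>_def)
  qed
  ultimately show ?thesis by (intro exI[of _ "\<gamma> ` {0..1}"]) auto
qed

section \<open>Faces as regions given by the pseudolines below them\<close>

context arrangement
begin

lemma cont: "f \<in> A \<Longrightarrow> continuous_on S f"
  using pseudoline continuous_on_subset unfolding pseudoline_arrangement_def by blast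

definition region :: "(real \<Rightarrow> real) set \<Rightarrow> (real \<times> real) set" where
  "region B = {p. \<forall>f\<in>A. if f \<in> B then f (fst p) < snd p else snd p < f (fst p)}"

lemma region_subset: "region B \<subseteq> - (\<Union>f\<in>A. curve f)"
  by (fastforce simp: region_def curve_def split: if_splits)

lemma region_inject:
  assumes "p \<in> region B" "p \<in> region C" "B \<subseteq> A" "C \<subseteq> A"
  shows "B = C"
  using assms unfolding region_def by (auto split: if_splits) (metis order_less_asym subsetD)+

lemma connected_region:
  assumes "connected C" "C \<subseteq> - (\<Union>f\<in>A. curve f)" "p \<in> C" "p \<in> region B"
  shows "C \<subseteq> region B"
proof
  fix q assume q: "q \<in> C"
  have "if f \<in> B then f (fst q) < snd q else snd q < f (fst q)" if f: "f \<in> A" for f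
  proof -
    have c: "continuous_on C (\<lambda>p. f (fst p))"
      by (rule continuous_on_compose2[OF cont[OF f, of UNIV]]) (auto intro: continuous_intros)
    have nz: "snd z \<noteq> f (fst z)" if "z \<in> C" for z
      using that assms(2) f by (cases z) (auto simp: curve_def)
    show ?thesis
    proof (cases "f \<in> B")
      case True
      have "0 < snd q - f (fst q)"
        by (rule connected_same_sign[OF assms(1) _ _ assms(3) q, where \<phi> = "\<lambda>p. snd p - f (fst p)"])
          (use c nz True assms(4) f in \<open>auto simp: region_def intro!: continuous_intros\<close>)
      then show ?thesis using True by simp
    next
      case False
      have "0 < f (fst q) - snd q"
        by (rule connected_same_sign[OF assms(1) _ _ assms(3) q, where \<phi> = "\<lambda>p. f (fst p) - snd p"])
          (use c nz False assms(4) f in \<open>fastforce simp: region_def intro!: continuous_intros\<close>)+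
      then show ?thesis using False by simp
    qed
  qed
  then show "q \<in> region B" by (simp add: region_def)
qed

text \<open>A member of \<open>B\<close> and a pseudoline outside \<open>B\<close> have the same
  order at both abscissae, hence also in between, as they cross once. The two families bound a strip
  that joins the two points within the region.\<close>

lemma region_connected: "connected (region B)"
  unfolding connected_iff_connected_component
proof (intro ballI)
  fix p p' assume pr: "p \<in> region B" "p' \<in> region B"
  obtain x y x' y' where p: "p = (x, y)" "p' = (x', y')" by (cases p, cases p') auto
  have in_region: "f \<in> A \<Longrightarrow> f \<in> B \<Longrightarrow> f x < y" "f \<in> A \<Longrightarrow> f \<notin> B \<Longrightarrow> y < f x"
    "f \<in> A \<Longrightarrow> f \<in> B \<Longrightarrow> f x' < y'" "f \<in> A \<Longrightarrow> f \<notin> B \<Longrightarrow> y' < f x'" for f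
    using pr p by (auto simp: region_def split: if_splits)
  let ?K = "{min x x'..max x x'}"
  have "bounded (f ` ?K)" if "f \<in> A" for f
    using compact_continuous_image[OF cont[OF that]] compact_Icc compact_imp_bounded by blast
  then have "bounded (\<Union>f\<in>A. f ` ?K)" using finite_A by (intro bounded_UN) auto
  then have "bounded ({y, y'} \<union> (\<Union>f\<in>A. f ` ?K))" by simp
  then obtain M where M: "\<And>z. z \<in> {y, y'} \<union> (\<Union>f\<in>A. f ` ?K) \<Longrightarrow> norm z < M"
    unfolding bounded_pos_less by blast
  have My: "\<bar>y\<bar> < M" "\<bar>y'\<bar> < M" using M[of y] M[of y'] by auto
  have Mf: "\<bar>f z\<bar> < M" if "f \<in> A" "z \<in> ?K" for f z
  proof -
    have "f z \<in> {y, y'} \<union> (\<Union>f\<in>A. f ` ?K)" using that by blast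
    from M[OF this] show ?thesis by simp
  qed
  \<comment> \<open>The constant bounds keep both families nonempty.\<close>
  let ?I = "insert (\<lambda>_. - M) (A \<inter> B)" and ?J = "insert (\<lambda>_. M) (A - B)"
  have "\<exists>T. connected T \<and> (x, y) \<in> T \<and> (x', y') \<in> T \<and>
    (\<forall>z\<in>T. (\<forall>f\<in>?I. f (fst z) < snd z) \<and> (\<forall>g\<in>?J. snd z < g (fst z)))"
  proof (rule strip_connected)
    fix f g z assume fg: "f \<in> ?I" "g \<in> ?J" and z: "z \<in> ?K"
    consider "f = (\<lambda>_. - M)" | "g = (\<lambda>_. M)" | "f \<in> A \<inter> B" "g \<in> A - B" using fg by blast
    then show "f z < g z"
    proof cases
      case 1
      then show ?thesis using fg(2) Mf[OF _ z, of g] My by auto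
    next
      case 2
      then show ?thesis using fg(1) Mf[OF _ z, of f] My by auto
    next
      case 3
      then have cr: "cross_once f g" using cross by blast
      have l: "f x < g x" "f x' < g x'" using in_region[of f] in_region[of g] 3 by force+
      show ?thesis
        using cross_once_convex[OF cr l] cross_once_convex[OF cr l(2,1)] z
        by (cases "x \<le> x'") (auto simp: min_def max_def)
    qed
  qed (use finite_A cont in_region My in \<open>auto simp: abs_less_iff\<close>)
  then obtain T where T: "connected T" "p \<in> T" "p' \<in> T"
    "\<And>z f. z \<in> T \<Longrightarrow> f \<in> A \<inter> B \<Longrightarrow> f (fst z) < snd z" "\<And>z f. z \<in> T \<Longrightarrow> f \<in> A - B \<Longrightarrow> snd z < f (fst z)"
    using p by blast
  then have "T \<subseteq> region B" by (auto simp: region_def)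
  then show "connected_component (region B) p p'" using T unfolding connected_component_def by blast
qed

text \<open>A connected set that avoids all curves cannot leave a region. As the region is itself
  connected, it is a whole component.\<close>

lemma region_face:
  assumes "p \<in> region B"
  shows "region B \<in> faces A"
proof -
  have "connected_component_set (- (\<Union>f\<in>A. curve f)) p = region B"
  proof
    show "connected_component_set (- (\<Union>f\<in>A. curve f)) p \<subseteq> region B"
      using assms region_subset
      by (intro connected_region[of _ p]) (auto simp: connected_component_subset)
    show "region B \<subseteq> connected_component_set (- (\<Union>f\<in>A. curve f)) p"
      by (rule connected_component_maximal[OF assms region_connected region_subset])
  qed
  then show ?thesis using assms region_subset unfolding faces_def components_def by blast
qed

text \<open>All other pseudolines miss the point, so a short vertical segment through it meets
  \<open>f\<close> only: it lies in \<open>region B\<close> below the point and in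
  \<open>region (insert f B)\<close> above it.\<close>

lemma region_near_curve:
  assumes f: "f \<in> A" "f \<notin> B" and g: "\<And>g. g \<in> A \<Longrightarrow> g \<noteq> f \<Longrightarrow> if g \<in> B then g x < f x else f x < g x"
  shows "(x, f x) \<in> frontier (region B) \<and> (x, f x) \<in> frontier (region (insert f B))"
proof -
  have "finite ((\<lambda>g. \<bar>g x - f x\<bar>) ` (A - {f}))" using finite_A by simp
  then obtain d where d: "0 < d" "\<And>g. g \<in> A \<Longrightarrow> g \<noteq> f \<Longrightarrow> d < \<bar>g x - f x\<bar>"
  proof -
    \<comment> \<open>The element 1 serves the case that \<open>f\<close> is the only pseudoline;
      halving \<open>D\<close> later gives a strict inequality.\<close>
    define D where "D = Min (insert 1 ((\<lambda>g. \<bar>g x - f x\<bar>) ` (A - {f})))"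
    have "0 < D" using finite_A g by (fastforce simp: D_def split: if_splits)
    moreover have "D \<le> \<bar>g x - f x\<bar>" if "g \<in> A" "g \<noteq> f" for g
      using finite_A that by (auto simp: D_def)
    ultimately show ?thesis using that[of "D / 2"] by fastforce
  qed
  have 1: "(x, f x - e) \<in> region B" "(x, f x + e) \<in> region (insert f B)" if "0 < e" "e \<le> d" for e
    using that f g d(2) by (fastforce simp: region_def split: if_splits)+
  have 2: "\<exists>z\<in>region B. dist z (x, f x) < e" "\<exists>z\<in>region (insert f B). dist z (x, f x) < e"
    if "0 < e" for e
  proof -
    let ?e = "min d (e / 2)"
    have e: "0 < ?e" "?e \<le> d" "?e < e" using that d(1) by auto
    have "dist (x, f x - ?e) (x, f x) < e" "dist (x, f x + ?e) (x, f x) < e"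
      using e by (simp_all add: dist_prod_def dist_real_def)
    then show "\<exists>z\<in>region B. dist z (x, f x) < e" "\<exists>z\<in>region (insert f B). dist z (x, f x) < e"
      using 1[OF e(1,2)] by blast+
  qed
  have "(x, f x) \<notin> region C" for C using region_subset[of C] f(1) by (auto simp: curve_def)
  then have "(x, f x) \<notin> interior (region C)" for C using interior_subset by blast
  then show ?thesis using 2 by (auto simp: frontier_def closure_approachable)
qed

text \<open>The edge of \<open>f\<close> through a generic abscissa works. No other pseudoline meets
  it, so each one stays on a constant side along it, and \<open>region_near_curve\<close> puts all
  its points on both frontiers.\<close>

lemma link_shared_edge:
  assumes "link F G"
  shows "\<exists>e. shared_edge A (region F) (region G) e"
proof -
  obtain x i where x: "generic x" "i < card A" "F = low x i" "G = low x (Suc i)"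
    using assms by (auto simp: link_def)
  obtain f where f: "f \<in> A" "f \<notin> F" "G = insert f F" using link_insert[OF assms] by blast
  have side: "if g \<in> F then g x < f x else f x < g x" if g: "g \<in> A" "g \<noteq> f" for g
  proof (cases "g \<in> F")
    case True
    then show ?thesis using low_cut[OF x(1), of g i f] x f by simp
  next
    case False
    then show ?thesis using low_cut[OF x(1), of f "Suc i" g] x f g by auto
  qed
  let ?S = "curve f - vertices A"
  let ?p = "(x, f x)"
  define e where "e = connected_component_set ?S ?p"
  have pS: "?p \<in> ?S"
    using crossingsI x(1) by (fastforce simp: curve_def vertices_def)
  then have e: "e \<in> edges A" "e \<subseteq> ?S" "connected e" "?p \<in> e"
    using f(1) connected_component_subset by (auto simp: e_def edges_def components_def)
  have sign: "if g \<in> F then g z < f z else f z < g z" if g: "g \<in> A" "g \<noteq> f" and z: "(z, f z) \<in> e" for g z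
  proof -
    have c: "continuous_on e (\<lambda>p. h (fst p))" if "h \<in> A" for h
      by (rule continuous_on_compose2[OF cont[OF that, of UNIV]]) (auto intro: continuous_intros)
    have nz: "f (fst q) \<noteq> g (fst q)" if "q \<in> e" for q
      using that e(2) g f(1) by (cases q) (fastforce simp: curve_def vertices_def)
    show ?thesis
    proof (cases "g \<in> F")
      case True
      have "0 < f (fst (z, f z)) - g (fst (z, f z))"
        by (rule connected_same_sign[OF e(3) _ _ e(4) z, where \<phi> = "\<lambda>p. f (fst p) - g (fst p)"])
          (use c nz side[OF g] True f(1) g(1) in \<open>auto intro!: continuous_intros\<close>)
      then show ?thesis using True by simp
    next
      case False
      have "0 < g (fst (z, f z)) - f (fst (z, f z))"
        by (rule connected_same_sign[OF e(3) _ _ e(4) z, where \<phi> = "\<lambda>p. g (fst p) - f (fst p)"])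
          (use c nz side[OF g] False f(1) g(1) in \<open>fastforce intro!: continuous_intros\<close>)+
      then show ?thesis using False by simp
    qed
  qed
  have "q \<in> frontier (region F) \<and> q \<in> frontier (region G)" if q: "q \<in> e" for q
  proof -
    obtain z where z: "q = (z, f z)" using q e(2) unfolding curve_def by blast
    show ?thesis using region_near_curve[OF f(1,2), of z] sign q z f(3) by blast
  qed
  then show ?thesis using e(1) by (auto simp: shared_edge_def)
qed

text \<open>The inequality passes to the closure in weak form and is strict again because the point
  is off the curve.\<close>

lemma frontier_region_sign:
  assumes "p \<in> frontier (region B)" "f \<in> A" "p \<notin> curve f"
  shows "f \<in> B \<longleftrightarrow> f (fst p) < snd p"
proof -
  have p: "p \<in> closure (region B)" using assms(1) by (simp add: frontier_def)
  have c: "continuous_on UNIV (\<lambda>p::real \<times> real. f (fst p))"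
    by (rule continuous_on_compose2[OF cont[OF assms(2), of UNIV]]) (auto intro: continuous_intros)
  have "if f \<in> B then f (fst p) \<le> snd p else snd p \<le> f (fst p)"
  proof (cases "f \<in> B")
    case True
    have "closed {p. f (fst p) \<le> snd p}"
      using c by (intro closed_Collect_le continuous_intros)
    moreover have "region B \<subseteq> {p. f (fst p) \<le> snd p}" using True assms(2) by (fastforce simp: region_def)
    ultimately have "p \<in> {p. f (fst p) \<le> snd p}" using p closure_minimal by blast
    then show ?thesis using True by simp
  next
    case False
    have "closed {p. snd p \<le> f (fst p)}" using c by (intro closed_Collect_le continuous_intros)
    moreover have "region B \<subseteq> {p. snd p \<le> f (fst p)}" using False assms(2) by (fastforce simp: region_def)
    ultimately have "p \<in> {p. snd p \<le> f (fst p)}" using p closure_minimal by blast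
    then show ?thesis using False by simp
  qed
  moreover have "snd p \<noteq> f (fst p)" using assms(3) by (cases p) (auto simp: curve_def)
  ultimately show ?thesis by (auto split: if_splits)
qed

text \<open>A point of the edge lies on a single pseudoline, so both faces are on the same side of
  every other one. Since the sets differ, they differ in the pseudoline that carries the
  edge.\<close>

lemma shared_edge_colour:
  assumes "shared_edge A (region F) (region G) e" "F \<subseteq> A" "G \<subseteq> A" "F \<noteq> G"
  shows "\<exists>f \<in> sym_diff F G. edge_colour A \<kappa> e = \<kappa> f"
proof -
  have e: "e \<in> edges A" "e \<subseteq> frontier (region F)" "e \<subseteq> frontier (region G)"
    using assms(1) by (auto simp: shared_edge_def)
  obtain f where f: "f \<in> A" "e \<in> components (curve f - vertices A)" using e(1) by (auto simp: edges_def)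
  then have sub: "e \<subseteq> curve f - vertices A" and "e \<noteq> {}"
    by (auto dest: in_components_subset in_components_nonempty)
  then obtain p where p: "p \<in> e" "p \<in> curve f" "p \<notin> vertices A" by blast
  have "g \<in> F \<longleftrightarrow> g \<in> G" if "g \<in> A" "g \<noteq> f" for g
  proof -
    have "p \<notin> curve g" using p f(1) that by (auto simp: vertices_def)
    then show ?thesis using frontier_region_sign[of p _ g] e p(1) that(1) by blast
  qed
  then have "f \<in> sym_diff F G" using assms(2-4) by blast
  moreover have "(THE f. f \<in> A \<and> e \<subseteq> curve f) = f"
    using edge_in_unique_curve[OF e(1)] f(1) sub by (intro the1_equality) auto
  ultimately show ?thesis by (auto simp: edge_colour_def)
qed

lemma cell_region_nonempty:
  assumes "F \<in> cells"
  shows "region F \<noteq> {}"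
proof -
  obtain x i where x: "generic x" "F = low x i" using assms by (auto simp: cells_def)
  have "\<exists>y. (\<forall>a\<in>(\<lambda>f. f x) ` F. a < y) \<and> (\<forall>b\<in>(\<lambda>f. f x) ` (A - F). y < b)"
    using finite_A finite_cell[OF assms] low_cut[OF x(1)] x(2)
    by (intro finite_separation) auto
  then obtain y where "\<And>f. f \<in> F \<Longrightarrow> f x < y" "\<And>f. f \<in> A - F \<Longrightarrow> y < f x" by auto
  then have "(x, y) \<in> region F" by (simp add: region_def)
  then show ?thesis by blast
qed

text \<open>The edge crossed on leaving a face has the exit colour of its cardinality, and
  consecutive cardinalities have opposite parity.\<close>

lemma arc_path_alternating:
  assumes path: "arc_path (arc \<kappa>) Fs" and cells: "set Fs \<subseteq> cells"
  shows "alternating_dual_path A \<kappa> (map region Fs)"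
proof -
  have arc: "arc \<kappa> (Fs ! j) (Fs ! Suc j)" if "Suc j < length Fs" for j
    using path that by (simp add: arc_path_def)
  have cell: "Fs ! j \<in> cells" if "j < length Fs" for j using cells nth_mem that by blast
  have inj: "inj_on region cells"
    using region_inject cells_subset cell_region_nonempty unfolding inj_on_def by (metis ex_in_conv)
  have colour: "edge_colour A \<kappa> e = exit_colour (card (Fs ! j))"
    if j: "Suc j < length Fs" and e: "shared_edge A (map region Fs ! j) (map region Fs ! Suc j) e" for j e
  proof -
    have "Fs ! j \<noteq> Fs ! Suc j"
      using path j by (auto simp: arc_path_def nth_eq_iff_index_eq)
    moreover have "Fs ! j \<subseteq> A" "Fs ! Suc j \<subseteq> A" using cell cells_subset j by simp_all
    ultimately have "\<exists>f \<in> sym_diff (Fs ! j) (Fs ! Suc j). edge_colour A \<kappa> e = \<kappa> f"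
      using shared_edge_colour[of "Fs ! j" "Fs ! Suc j" e \<kappa>] e j by simp
    then show ?thesis using arc[OF j] unfolding arc_def by metis
  qed
  have "dual_path A (map region Fs)"
    unfolding dual_path_def
  proof (intro conjI allI impI)
    show "map region Fs \<noteq> []" using path by (simp add: arc_path_def)
    show "set (map region Fs) \<subseteq> faces A"
      using cells cell_region_nonempty region_face by fastforce
    show "distinct (map region Fs)"
      using path inj cells by (auto simp: distinct_map arc_path_def intro: inj_on_subset)
    fix j assume "Suc j < length (map region Fs)"
    then show "\<exists>e. shared_edge A (map region Fs ! j) (map region Fs ! Suc j) e"
      using arc[of j] link_shared_edge[of "Fs ! j" "Fs ! Suc j"] link_shared_edge[of "Fs ! Suc j" "Fs ! j"]
      by (auto simp: arc_def shared_edge_def)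
  qed
  moreover have "edge_colour A \<kappa> e \<noteq> edge_colour A \<kappa> e'"
    if j: "Suc (Suc j) < length (map region Fs)"
      and e: "shared_edge A (map region Fs ! j) (map region Fs ! Suc j) e"
      and e': "shared_edge A (map region Fs ! Suc j) (map region Fs ! Suc (Suc j)) e'" for j e e'
  proof -
    have "\<bar>int (card (Fs ! Suc j)) - int (card (Fs ! j))\<bar> = 1" using arc_sdist(2)[OF arc[of j]] j by simp
    then have "even (card (Fs ! Suc j)) \<noteq> even (card (Fs ! j))" by presburger
    then show ?thesis using colour[OF _ e] colour[OF _ e'] j by (simp add: exit_colour_def)
  qed
  ultimately show ?thesis by (simp add: alternating_dual_path_def)
qed

end

section \<open>Random colourings\<close>

context arrangement
begin

text \<open>A column depends only on the number of crossing abscissae to its left, so this number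
  and the row encode a cell. A polynomial bound suffices for the union bound below.\<close>

lemma card_cells: "finite cells" "card cells \<le> ((card A)\<^sup>2 + 1) * (card A + 1)"
proof -
  define key where "key x = card (crossings \<inter> {..<x})" for x
  define pick where "pick k = (SOME x. generic x \<and> key x = k)" for k
  have key_le: "key x \<le> (card A)\<^sup>2" for x
    using card_mono[OF crossings_bound(1), of "crossings \<inter> {..<x}"] crossings_bound(2)
    by (simp add: key_def)
  have key_eq: "low x i = low x' i"
    if "generic x" "generic x'" "x \<le> x'" "key x = key x'" "i \<le> card A" for x x' i
  proof (cases "x = x'")
    case False
    have "crossings \<inter> {..<x} \<subseteq> crossings \<inter> {..<x'}" using that by auto
    then have "crossings \<inter> {..<x} = crossings \<inter> {..<x'}"
      using card_subset_eq[of "crossings \<inter> {..<x'}"] crossings_bound(1) that(4)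
      by (simp add: key_def)
    moreover have "crossings \<inter> {x<..<x'} \<subseteq> (crossings \<inter> {..<x'}) - {..<x}" by auto
    ultimately have "crossings \<inter> {x<..<x'} = {}" by blast
    then show ?thesis using low_eq_of_no_crossing that False by simp
  qed simp
  have "cells \<subseteq> (\<lambda>(k, i). low (pick k) i) ` ({..(card A)\<^sup>2} \<times> {..card A})"
  proof
    fix F assume "F \<in> cells"
    then obtain x i where x: "generic x" "i \<le> card A" "F = low x i" by (auto simp: cells_def)
    have pick: "generic (pick (key x)) \<and> key (pick (key x)) = key x"
      unfolding pick_def by (rule someI_ex) (use x(1) in blast)
    have "low x i = low (pick (key x)) i"
    proof (cases "x \<le> pick (key x)")
      case True
      then show ?thesis using key_eq[OF x(1) _ True _ x(2)] pick by simp
    next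
      case False
      then show ?thesis using key_eq[OF _ x(1) _ _ x(2), of "pick (key x)"] pick by simp
    qed
    with x(3) have "F = low (pick (key x)) i" by simp
    then show "F \<in> (\<lambda>(k, i). low (pick k) i) ` ({..(card A)\<^sup>2} \<times> {..card A})"
      using key_le[of x] x(2) by (intro image_eqI[of _ _ "(key x, i)"]) auto
  qed
  then show "finite cells" "card cells \<le> ((card A)\<^sup>2 + 1) * (card A + 1)"
    using finite_surj[of "{..(card A)\<^sup>2} \<times> {..card A}"] surj_card_le[of "{..(card A)\<^sup>2} \<times> {..card A}"]
    by (auto simp: card_cartesian_product)
qed

lemma prob_monochromatic:
  assumes "D \<subseteq> A"
  shows "measure_pmf.prob (random_colouring A) {\<kappa>. \<forall>f\<in>D. \<kappa> f = c} = (1/2) ^ card D"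
proof -
  let ?B = "\<lambda>f. if f \<in> D then {c} else UNIV"
  have half: "measure_pmf.prob (pmf_of_set {Red, Blue}) {c} = 1/2"
    by (cases c) (simp_all add: measure_pmf_single)
  have "{\<kappa>. \<forall>f\<in>D. \<kappa> f = c} = Pi A ?B"
    using assms by (auto simp: Pi_def split: if_splits)
  then have "measure_pmf.prob (random_colouring A) {\<kappa>. \<forall>f\<in>D. \<kappa> f = c} =
    (\<Prod>f\<in>A. measure_pmf.prob (pmf_of_set {Red, Blue}) (?B f))"
    by (simp add: random_colouring_def measure_Pi_pmf_Pi finite_A)
  also have "\<dots> = (\<Prod>f\<in>A. if f \<in> D then 1/2 else 1)"
    using half by (intro prod.cong) auto
  also have "\<dots> = (\<Prod>f\<in>D. 1/2)"
    using assms finite_A by (simp add: prod.If_cases Int_absorb1)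
  finally show ?thesis by simp
qed

text \<open>Union bound over two faces and a colour: failure means that some pair separated by at
  least \<open>h\<close> pseudolines has all of them in one colour.\<close>

lemma prob_not_mixed:
  "measure_pmf.prob (random_colouring A) {\<kappa>. \<not> mixed h \<kappa>} \<le> 2 * (real (card cells))\<^sup>2 * (1/2) ^ h"
proof -
  define J where "J = {(F, G). F \<in> cells \<and> G \<in> cells \<and> h \<le> sdist F G} \<times> {Red, Blue}"
  define E where "E = (\<lambda>((F, G), c). {\<kappa>. \<forall>f \<in> sym_diff F G. \<kappa> f = c} :: ((real \<Rightarrow> real) \<Rightarrow> colour) set)"
  have sub: "J \<subseteq> (cells \<times> cells) \<times> {Red, Blue}" by (auto simp: J_def)
  have fin: "finite J" by (rule finite_subset[OF sub]) (use card_cells(1) in auto)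
  have "card J \<le> card ((cells \<times> cells) \<times> {Red, Blue})"
    by (rule card_mono[OF _ sub]) (use card_cells(1) in auto)
  then have cJ: "card J \<le> 2 * (card cells)\<^sup>2"
    by (simp add: card_cartesian_product power2_eq_square)
  have prob_E: "measure_pmf.prob (random_colouring A) (E j) \<le> (1/2) ^ h" if "j \<in> J" for j
  proof -
    obtain F G c where j: "j = ((F, G), c)" "F \<in> cells" "G \<in> cells" "h \<le> sdist F G"
      using \<open>j \<in> J\<close> by (auto simp: J_def)
    have "sym_diff F G \<subseteq> A" using cells_subset j by blast
    then have "measure_pmf.prob (random_colouring A) (E j) = (1/2) ^ sdist F G"
      using prob_monochromatic j(1) by (simp add: E_def sdist_def)
    also have "\<dots> \<le> (1/2) ^ h" using j(4) by (intro power_decreasing) auto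
    finally show ?thesis .
  qed
  have "\<kappa> \<in> (\<Union>j\<in>J. E j)" if nm: "\<not> mixed h \<kappa>" for \<kappa>
  proof -
    obtain F G c where "F \<in> cells" "G \<in> cells" "h \<le> sdist F G" "\<forall>f \<in> sym_diff F G. \<kappa> f = c"
      using nm unfolding mixed_def by blast
    then have "((F, G), c) \<in> J" "\<kappa> \<in> E ((F, G), c)"
      by (cases c; simp add: J_def E_def)+
    then show ?thesis by blast
  qed
  then have "measure_pmf.prob (random_colouring A) {\<kappa>. \<not> mixed h \<kappa>} \<le>
    measure_pmf.prob (random_colouring A) (\<Union>j\<in>J. E j)"
    by (intro measure_pmf.finite_measure_mono) auto
  also have "\<dots> \<le> (\<Sum>j\<in>J. measure_pmf.prob (random_colouring A) (E j))"
    using fin by (intro measure_UNION_le) auto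
  also have "\<dots> \<le> real (card J) * (1/2) ^ h"
    using sum_bounded_above[of J "\<lambda>j. measure_pmf.prob (random_colouring A) (E j)", OF prob_E] by simp
  also have "\<dots> \<le> real (2 * (card cells)\<^sup>2) * (1/2) ^ h"
    using cJ by (intro mult_right_mono) (simp_all only: of_nat_le_iff, simp)
  finally show ?thesis by simp
qed

end

section \<open>Choice of the parameters\<close>

lemma cells_power_bound:
  fixes n :: nat
  assumes "2 \<le> n"
  shows "(n\<^sup>2 + 1) * (n + 1) \<le> n ^ 4"
proof -
  \<comment> \<open>After this shift the difference of the two sides is a polynomial in
    \<open>k\<close> with nonnegative coefficients.\<close>
  obtain k where k: "n = k + 2" using assms by (metis le_add_diff_inverse2)
  show ?thesis unfolding k by (simp add: power2_eq_square power4_eq_xxxx algebra_simps)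
qed

text \<open>The constant 1280 is 8 * 8 * 20: the path has length at least \<open>q * q / H\<close>,
  where \<open>n \<le> 8 * q\<close> and \<open>H\<close> is at most 20 times the logarithm of
  \<open>n\<close>.\<close>

lemma prob_no_long_alternating_path:
  assumes n: "1638400 \<le> n" and A: "pseudoline_arrangement A" "simple_arrangement A" "card A = n"
  shows "measure_pmf.prob (random_colouring A) (- {col. \<exists>fs. alternating_dual_path A col fs \<and>
    real (length fs) \<ge> 1 / 1280 * (real n)\<^sup>2 / ln (real n)}) \<le> 2 / real n"
proof -
  interpret arrangement A using A by unfold_locales
  let ?n = "real n" and ?l = "ln (real n)"
  have n1: "1638400 \<le> ?n" using n by simp
  have l1: "1 \<le> ?l" using exp_le n1 by (subst ln_ge_iff) auto
  \<comment> \<open>\<open>1638400 = 1280\<^sup>2\<close>\<close>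
  have "?l = 2 * ln (sqrt ?n)" using n1 by (simp add: ln_sqrt)
  also have "\<dots> \<le> 2 * sqrt ?n" using ln_le_minus_one[of "sqrt ?n"] n1 by simp
  finally have "640 * ?l \<le> 1280 * sqrt ?n" by simp
  also have "\<dots> \<le> sqrt ?n * sqrt ?n"
  proof (rule mult_right_mono)
    have "sqrt (1280\<^sup>2) \<le> sqrt ?n" using n1 by (intro real_sqrt_le_mono) simp
    then show "1280 \<le> sqrt ?n" by simp
  qed simp
  finally have ln_small: "640 * ?l \<le> ?n" using n1 by simp
  \<comment> \<open>Since ln 2 is at least 2/3, the factor 15 gives
    \<open>2 ^ h \<ge> n ^ 10\<close>, which outweighs the at most \<open>(n ^ 4)\<^sup>2\<close>
    pairs of faces.\<close>
  define h where "h = nat \<lceil>15 * ?l\<rceil>"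
  have h_ge: "15 * ?l \<le> real h" and h_le: "real h \<le> 15 * ?l + 1" using l1 unfolding h_def by linarith+
  have pow: "?n ^ 10 \<le> 2 ^ h"
  proof -
    have "?n ^ 10 = exp (10 * ?l)" using n1 exp_of_nat_mult[of 10 ?l] by simp
    also have "10 * ?l \<le> real h * ln 2"
      using mult_mono[OF h_ge ln2_ge_two_thirds] l1 by simp
    also have "exp (real h * ln 2) = 2 ^ h" by (simp add: exp_of_nat_mult)
    finally show ?thesis by simp
  qed
  define H where "H = h + 4"
  define q where "q = n div 4"
  have H_le: "real H \<le> 20 * ?l" using h_le l1 by (simp add: H_def)
  have q_ge: "?n \<le> 8 * real q" using n unfolding q_def by linarith
  have "real (4 * H) \<le> real q" using H_le ln_small q_ge by simp
  then have Hq: "4 * H \<le> q" by (simp only: of_nat_le_iff)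
  have q4: "4 * q \<le> n" by (simp add: q_def)
  have H0: "0 < H" by (simp add: H_def)
  \<comment> \<open>The largest number of tooth rows with \<open>q + t * H < n - q\<close>;
    subtracting 1 accounts for the strict inequality.\<close>
  define t where "t = (n - 2 * q - 1) div H"
  have tH: "t * H \<le> n - 2 * q - 1" by (simp add: t_def)
  have "n - 2 * q - 1 < Suc t * H"
    unfolding t_def using H0 by (metis dividend_less_div_times mult.commute mult_Suc)
  then have Ht: "2 * q \<le> t * H + H" using q4 by simp
  have t1: "1 \<le> t" using Ht Hq H0 by (cases t) auto
  have tq: "q + t * H < n - q" using tH q4 Hq H0 by linarith
  \<comment> \<open>Both \<open>(t - 1) * H\<close> and \<open>2 * q - 4 * H\<close> are at least
    \<open>q\<close>, because \<open>4 * H \<le> q\<close> and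
    \<open>2 * q \<le> t * H + H\<close>.\<close>
  have long: "1 / 1280 * ?n\<^sup>2 / ?l \<le> real ((t - 1) * (2 * q - 4 * H))"
  proof -
    have "(t - 1) * H + H = t * H" using t1 by (cases t) auto
    then have "q \<le> (t - 1) * H" using Ht Hq by linarith
    moreover have "q \<le> 2 * q - 4 * H" using Hq by linarith
    ultimately have "q * q \<le> ((t - 1) * H) * (2 * q - 4 * H)" by (rule mult_mono) auto
    then have "real (q * q) \<le> real (((t - 1) * (2 * q - 4 * H)) * H)"
      by (subst of_nat_le_iff) (simp add: mult.commute mult.left_commute)
    also have "\<dots> = real ((t - 1) * (2 * q - 4 * H)) * real H" by (rule of_nat_mult)
    also have "\<dots> \<le> real ((t - 1) * (2 * q - 4 * H)) * (20 * ?l)"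
      using H_le by (intro mult_left_mono) auto
    finally have "real q * real q \<le> real ((t - 1) * (2 * q - 4 * H)) * (20 * ?l)" by simp
    moreover have "(?n / 8) * (?n / 8) \<le> real q * real q" using q_ge n1 by (intro mult_mono) auto
    ultimately show ?thesis using l1 by (simp add: field_simps power2_eq_square)
  qed
  have good: "\<exists>fs. alternating_dual_path A \<kappa> fs \<and> real (length fs) \<ge> 1 / 1280 * ?n\<^sup>2 / ?l"
    if "mixed h \<kappa>" for \<kappa>
  proof -
    have "\<exists>Fs. arc_path (arc \<kappa>) Fs \<and> set Fs \<subseteq> cells \<and> (t - 1) * (2 * q - 4 * H) \<le> length Fs"
      by (rule long_arc_path[OF that H_def]) (use Hq q4 H0 t1 tq A(3) in auto)
    then obtain Fs where Fs: "arc_path (arc \<kappa>) Fs" "set Fs \<subseteq> cells"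
      "(t - 1) * (2 * q - 4 * H) \<le> length Fs" by blast
    have "real ((t - 1) * (2 * q - 4 * H)) \<le> real (length Fs)" using Fs(3) by (simp only: of_nat_le_iff)
    then have "1 / 1280 * ?n\<^sup>2 / ?l \<le> real (length (map region Fs))"
      using long unfolding length_map by linarith
    then show ?thesis using arc_path_alternating[OF Fs(1,2)] by blast
  qed
  have "measure_pmf.prob (random_colouring A) (- {col. \<exists>fs. alternating_dual_path A col fs \<and>
    real (length fs) \<ge> 1 / 1280 * ?n\<^sup>2 / ?l}) \<le>
    measure_pmf.prob (random_colouring A) {\<kappa>. \<not> mixed h \<kappa>}"
    using good by (intro measure_pmf.finite_measure_mono) auto
  also have "\<dots> \<le> 2 * (real (card cells))\<^sup>2 * (1/2) ^ h" by (rule prob_not_mixed)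
  also have "\<dots> \<le> 2 * (?n ^ 4)\<^sup>2 * (1 / ?n ^ 10)"
  proof (intro mult_mono power_mono)
    have "card cells \<le> n ^ 4"
      using card_cells(2) cells_power_bound[of n] n A(3) by simp
    then have "real (card cells) \<le> real (n ^ 4)" by (simp only: of_nat_le_iff)
    then show "real (card cells) \<le> ?n ^ 4" by simp
    show "(1/2) ^ h \<le> 1 / ?n ^ 10"
      using pow n1 by (simp add: power_one_over frac_le)
  qed auto
  also have "\<dots> = 2 / (?n * ?n)"
    using n1 by (simp add: field_simps power_numeral_reduce)
  also have "\<dots> \<le> 2 / ?n" using n1 by (intro frac_le) auto
  finally show ?thesis .
qed

theorem theorem3:
  shows "\<exists>c::real. c > 0 \<and>
    (\<forall>\<epsilon>::real. \<epsilon> > 0 \<longrightarrow>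
      (\<exists>N::nat. \<forall>n\<ge>N. \<forall>A::(real \<Rightarrow> real) set.
         pseudoline_arrangement A \<and> simple_arrangement A \<and> card A = n \<longrightarrow>
         measure_pmf.prob (random_colouring A)
           {col. \<exists>fs. alternating_dual_path A col fs \<and>
                      real (length fs) \<ge> c * (real n)\<^sup>2 / ln (real n)} \<ge> 1 - \<epsilon>))"
proof (rule exI[of _ "1 / 1280"], intro conjI allI impI)
  fix \<epsilon> :: real assume \<epsilon>: "0 < \<epsilon>"
  show "\<exists>N::nat. \<forall>n\<ge>N. \<forall>A::(real \<Rightarrow> real) set.
         pseudoline_arrangement A \<and> simple_arrangement A \<and> card A = n \<longrightarrow>
         measure_pmf.prob (random_colouring A)
           {col. \<exists>fs. alternating_dual_path A col fs \<and>
                      real (length fs) \<ge> 1 / 1280 * (real n)\<^sup>2 / ln (real n)} \<ge> 1 - \<epsilon>"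
  proof (rule exI[of _ "max 1638400 (nat \<lceil>2 / \<epsilon>\<rceil>)"], intro allI impI, elim conjE)
    fix n :: nat and A :: "(real \<Rightarrow> real) set"
    assume n: "max 1638400 (nat \<lceil>2 / \<epsilon>\<rceil>) \<le> n"
      and A: "pseudoline_arrangement A" "simple_arrangement A" "card A = n"
    let ?E = "{col. \<exists>fs. alternating_dual_path A col fs \<and>
      real (length fs) \<ge> 1 / 1280 * (real n)\<^sup>2 / ln (real n)}"
    have "2 / \<epsilon> \<le> real n" using n by linarith
    then have "2 / real n \<le> \<epsilon>" using \<epsilon> n by (simp add: field_simps)
    then have "measure_pmf.prob (random_colouring A) (- ?E) \<le> \<epsilon>"
      using prob_no_long_alternating_path[OF _ A] n by fastforce
    moreover have "measure_pmf.prob (random_colouring A) (- ?E) = 1 - measure_pmf.prob (random_colouring A) ?E"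
      using measure_pmf.prob_compl[of ?E "random_colouring A"] by (simp add: Compl_eq_Diff_UNIV)
    ultimately show "1 - \<epsilon> \<le> measure_pmf.prob (random_colouring A) ?E" by linarith
  qed
qed simp

end
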